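(* Let $\Delta(t)>0$ solve $$(\Delta')^2=C\Delta^2-2\beta\Delta$$ for constants $\beta,C$. Exactly one of the following occurs, and $C<0$ forces $\beta<0$ (so the case $C<0,\ \beta\ge0$ never arises for a solution with $\Delta>0$). On a maximal interval with $\Delta>0$: - $C<0$, $\beta<0$: $\Delta=A\,(1-\cos(kt+\phi))$, with $A,k>0$, $\beta=-Ak^2$, $C=-k^2$ (bounded oscillatory). - $C=0$, $\beta<0$: $\Delta=\tfrac{|\beta|}{2}(t-t_0)^2$ (parabolic degeneration). - $C=0$, $\beta=0$: $\Delta=\Delta_0>0$ constant. - $C=0$, $\beta>0$: no solution with $\Delta>0$. - $C>0$, $\beta<0$: $\Delta=-\tfrac{2\beta}{C}\sinh^2\!\big(\tfrac{\sqrt C}{2}(t-t_0)\big)$ (touches $0$ at $t_0$). - $C>0$, $\beta=0$: $\Delta=\Delta_0e^{\pm\sqrt C(t-t_0)}$ (exponential). - $C>0$, $\beta>0$: $\Delta=\tfrac{2\beta}{C}\cosh^2\!\big(\tfrac{\sqrt C}{2}(t-t_0)\big)$ (bounded away from $0$). For fixed $(\beta,C)$, each case above is a one-parameter family: the amplitude $A$ (or $\Delta_0$) and rate $k=\sqrt{|C|}/2$ (or $\sqrt C$) appearing in $\Delta(t)$ are themselves determined by $(\beta,C)$ via these formulas (e.g. $A=-2\beta/C$, $k=\sqrt C/2$ in the case $C>0,\beta<0$), leaving only the time-translation $t_0$ (or phase $\phi$) free, except in the degenerate case $C=\beta=0$, where $\Delta\equiv\Delta_0$ is itself the one free constant, there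 being no time-translation to fix (the solution is already time-independent). This single remaining freedom matches the one-parameter family of solutions of the first-order equation through a given $\Delta(t_1)>0$ at a given time $t_1$ (the sign of $\Delta'(t_1)$, where nonzero, is fixed by which branch of $\pm\sqrt{C\Delta^2-2\beta\Delta}$ the solution is on, and determines $t_0$ or $\phi$ uniquely). In particular the sign of $\beta$ alone does not determine boundedness: the case $C<0$ and the case $C>0,\beta<0$ both have $\beta<0$, yet the first is bounded, returning to $\Delta=0$ at evenly spaced times, while the second grows without bound.
   Context: $\Delta$ is a real-valued function of a real variable $t$, primes denote $t$-derivatives, and $\beta,C$ are real constants. The first-order equation is the first integral satisfied by $\Delta=\det h$ for a curve $h(t)$ of real symmetric invertible $2\times2$ matrices with $K=h^{-1}\dot h$, $\Xi=\operatorname{tr}K$ solving the Kasner master equation $2\dot K+K\Xi=(\Xi^2-\operatorname{tr}K^2)I$, where the conserved quantities are $\beta=-\Delta\operatorname{tr}\big((K-\tfrac{\Xi}{2}I)^2\big)$ and $C=4\det K$.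
   Formalization: Solutions equal to the constant 2β/C on an interval (C≠0) are excluded, as they solve the equation but fit no listed form; in 1−cos the rate is k=√|C|; for C>0, β=0, Δ₀ is any fixed normalisation, not determined by (β,C). *)

theory Defs
  imports "HOL-Analysis.Analysis"
begin

definition solves_on :: "real \<Rightarrow> real \<Rightarrow> (real \<Rightarrow> real) \<Rightarrow> real set \<Rightarrow> bool" where
  "solves_on \<beta> C \<Delta> J \<longleftrightarrow>
     (\<forall>t\<in>J. \<Delta> differentiable (at t) \<and> (deriv \<Delta> t)\<^sup>2 = C * (\<Delta> t)\<^sup>2 - 2 * \<beta> * \<Delta> t)"

definition positive_solution :: "real \<Rightarrow> real \<Rightarrow> (real \<Rightarrow> real) \<Rightarrow> real set \<Rightarrow> bool" where
  "positive_solution \<beta> C \<Delta> J \<longleftrightarrow>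
     open J \<and> connected J \<and> J \<noteq> {} \<and> (\<forall>t\<in>J. \<Delta> t > 0) \<and> solves_on \<beta> C \<Delta> J"

text \<open>
  For \<open>\<beta> / C > 0\<close> the first-order equation also has the singular constant solution
  \<open>\<Delta> = 2 * \<beta> / C\<close> (lemma \<open>singular_solution\<close>), and differentiable solutions obtained by
  gluing pieces of it to oscillating or \<open>cosh\<close> pieces.  None of these is the determinant
  of a curve solving the Kasner master equation: if \<open>\<Delta>\<close> is constant on an interval then
  \<open>\<Xi> = \<Delta>' / \<Delta> = 0\<close> there, the trace \<open>2 \<Xi>' = \<Xi>\<^sup>2 - 2 tr K\<^sup>2\<close> of the master equation
  gives \<open>tr K\<^sup>2 = 0\<close>, and so \<open>C = 4 det K = 2 (\<Xi>\<^sup>2 - tr K\<^sup>2) = 0\<close>.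
  The following condition excludes exactly these spurious solutions; it holds
  automatically unless \<open>\<beta> / C > 0\<close> (lemma \<open>nonsingular_automatic\<close>).
\<close>

definition nonsingular :: "real \<Rightarrow> real \<Rightarrow> (real \<Rightarrow> real) \<Rightarrow> real set \<Rightarrow> bool" where
  "nonsingular \<beta> C \<Delta> J \<longleftrightarrow>
     C = 0 \<or> \<not> (\<exists>a b. a < b \<and> {a<..<b} \<subseteq> J \<and> (\<forall>t\<in>{a<..<b}. \<Delta> t = 2 * \<beta> / C))"

lemma singular_solution:
  assumes "\<beta> / C > 0"
  shows "positive_solution \<beta> C (\<lambda>t. 2 * \<beta> / C) UNIV"
  using assms
  by (auto simp: positive_solution_def solves_on_def power2_eq_square zero_less_divide_iff)

lemma nonsingular_automatic:
  assumes "positive_solution \<beta> C \<Delta> J" "\<not> \<beta> / C > 0"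
  shows "nonsingular \<beta> C \<Delta> J"
  unfolding nonsingular_def
proof (intro disjI2 notI)
  assume "\<exists>a b. a < b \<and> {a<..<b} \<subseteq> J \<and> (\<forall>t\<in>{a<..<b}. \<Delta> t = 2 * \<beta> / C)"
  then obtain a b where ab: "a < b" "{a<..<b} \<subseteq> J" "\<forall>t\<in>{a<..<b}. \<Delta> t = 2 * \<beta> / C"
    by blast
  have m: "(a + b) / 2 \<in> {a<..<b}" using ab(1) by auto
  with ab have "\<Delta> ((a + b) / 2) = 2 * (\<beta> / C)" by simp
  moreover have "\<Delta> ((a + b) / 2) > 0"
    using m ab(2) assms(1) unfolding positive_solution_def by blast
  ultimately show False using assms(2) by linarith
qed

text \<open>Maximality refers to all positive solutions, singular ones included.\<close>

definition maximal_solution :: "real \<Rightarrow> real \<Rightarrow> (real \<Rightarrow> real) \<Rightarrow> real set \<Rightarrow> bool" where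
  "maximal_solution \<beta> C \<Delta> J \<longleftrightarrow>
     positive_solution \<beta> C \<Delta> J \<and> nonsingular \<beta> C \<Delta> J \<and>
     \<not> (\<exists>D I. J \<subset> I \<and> (\<forall>t\<in>J. D t = \<Delta> t) \<and> positive_solution \<beta> C D I)"

datatype regime =
  Oscillatory | Parabolic | Constant | No_Solution | Sinh_Type | Exponential | Cosh_Type

fun occurs :: "regime \<Rightarrow> real \<Rightarrow> real \<Rightarrow> (real \<Rightarrow> real) \<Rightarrow> real set \<Rightarrow> bool" where
  "occurs Oscillatory \<beta> C \<Delta> J \<longleftrightarrow> C < 0 \<and> \<beta> < 0 \<and>
     (\<exists>A k \<phi>. A > 0 \<and> k > 0 \<and> \<beta> = - A * k\<^sup>2 \<and> C = - (k\<^sup>2) \<and>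
        (\<forall>t\<in>J. \<Delta> t = A * (1 - cos (k * t + \<phi>))))"
| "occurs Parabolic \<beta> C \<Delta> J \<longleftrightarrow> C = 0 \<and> \<beta> < 0 \<and>
     (\<exists>t0. \<forall>t\<in>J. \<Delta> t = \<bar>\<beta>\<bar> / 2 * (t - t0)\<^sup>2)"
| "occurs Constant \<beta> C \<Delta> J \<longleftrightarrow> C = 0 \<and> \<beta> = 0 \<and>
     (\<exists>\<Delta>0>0. \<forall>t\<in>J. \<Delta> t = \<Delta>0)"
| "occurs No_Solution \<beta> C \<Delta> J \<longleftrightarrow> C = 0 \<and> \<beta> > 0 \<and>
     \<not> (\<exists>D I. positive_solution \<beta> C D I)"
| "occurs Sinh_Type \<beta> C \<Delta> J \<longleftrightarrow> C > 0 \<and> \<beta> < 0 \<and>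
     (\<exists>t0. \<forall>t\<in>J. \<Delta> t = - (2 * \<beta> / C) * (sinh (sqrt C / 2 * (t - t0)))\<^sup>2)"
| "occurs Exponential \<beta> C \<Delta> J \<longleftrightarrow> C > 0 \<and> \<beta> = 0 \<and>
     (\<exists>\<Delta>0>0. \<exists>\<sigma>\<in>{1, -1}. \<exists>t0. \<forall>t\<in>J. \<Delta> t = \<Delta>0 * exp (\<sigma> * sqrt C * (t - t0)))"
| "occurs Cosh_Type \<beta> C \<Delta> J \<longleftrightarrow> C > 0 \<and> \<beta> > 0 \<and>
     (\<exists>t0. \<forall>t\<in>J. \<Delta> t = 2 * \<beta> / C * (cosh (sqrt C / 2 * (t - t0)))\<^sup>2)"

text \<open>
  The functions \<open>F p\<close>, \<open>p \<in> P\<close>, restricted to the intervals in \<open>\<I> p\<close>, are precisely the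
  maximal solutions, each one with a unique parameter \<open>p\<close>; and \<open>p\<close> is uniquely
  determined by the value \<open>d > 0\<close> at a time \<open>t1\<close> together with the branch \<open>s\<close> of the
  square root.  (A zero of \<open>F p\<close> separates several intervals belonging to the same \<open>p\<close>.)
\<close>

definition solution_family ::
    "real \<Rightarrow> real \<Rightarrow> 'p set \<Rightarrow> ('p \<Rightarrow> real \<Rightarrow> real) \<Rightarrow> ('p \<Rightarrow> real set set) \<Rightarrow> bool" where
  "solution_family \<beta> C P F \<I> \<longleftrightarrow>
     (\<forall>p\<in>P. \<I> p \<noteq> {} \<and> (\<forall>J\<in>\<I> p. maximal_solution \<beta> C (F p) J)) \<and>
     (\<forall>\<Delta> J. maximal_solution \<beta> C \<Delta> J \<longrightarrow>
        (\<exists>!p. p \<in> P \<and> J \<in> \<I> p \<and> (\<forall>t\<in>J. \<Delta> t = F p t))) \<and>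
     (\<forall>t1 d s. d > 0 \<and> s \<in> {1, -1} \<and> C * d\<^sup>2 - 2 * \<beta> * d \<ge> 0 \<longrightarrow>
        (\<exists>!p. p \<in> P \<and> (\<exists>J\<in>\<I> p. t1 \<in> J) \<and> F p t1 = d \<and>
              deriv (F p) t1 = s * sqrt (C * d\<^sup>2 - 2 * \<beta> * d)))"

end

theory Submission
  imports Defs
begin

text \<open>
  Where \<open>\<Delta>' \<noteq> 0\<close>, the first-order equation differentiates to the linear equation
  \<open>\<Delta>'' = C * \<Delta> - \<beta>\<close>.  A nonsingular solution has at most one critical point (unless
  \<open>C = \<beta> = 0\<close>): by Rolle's argument it would otherwise be constantly \<open>2 * \<beta> / C\<close> between two
  of them.  Hence \<open>\<Delta>\<close> is determined by \<open>\<Delta>\<close> and \<open>\<Delta>'\<close> at one suitably chosen point, and it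
  coincides with the member of the explicit family with the same initial data.  The maximal intervals
  are the components of positivity of that member, because a positive solution cannot
  be continued through a zero.
\<close>

section \<open>Uniqueness of nonsingular solutions\<close>

text \<open>The obstacle is that the first-order equation does not determine its solutions:
  \<open>sqrt (C * d^2 - 2 * \<beta> * d)\<close> fails to be Lipschitz in \<open>d\<close> at a
  positive zero \<open>2 * \<beta> / C\<close> of the radicand, and this is where singular pieces
  can be glued on. The linear second-order equation has unique solutions, but
  \<open>\<Delta>\<close> is assumed differentiable only once, and at a critical point the
  second-order equation cannot be derived by differentiation. The comparison point is therefore the
  critical point itself, if there is one: an energy estimate started there needs the equation only
  away from its starting point, and at that point only continuity of the derivative.\<close>

lemma derivative_nonzero_pos:
  fixes f f' :: "real \<Rightarrow> real"
  assumes "a \<le> b"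
    and der: "\<And>x. x \<in> {a..b} \<Longrightarrow> (f has_real_derivative f' x) (at x)"
    and nz: "\<And>x. x \<in> {a..b} \<Longrightarrow> f' x \<noteq> 0"
    and "f' a > 0"
  shows "f' b > 0"
proof (rule ccontr)
  assume "\<not> f' b > 0"
  with nz[of b] \<open>a \<le> b\<close> have neg: "f' b < 0" by (simp add: less_le)
  have "continuous_on {a..b} f"
    using der by (meson continuous_at_imp_continuous_on DERIV_isCont)
  \<comment> \<open>Slopes \<open>f' a > 0\<close> and \<open>f' b < 0\<close> push the maximum of
    \<open>f\<close> off both endpoints, so \<open>f'\<close> would vanish at it.\<close>
  then obtain c where c: "c \<in> {a..b}" "\<And>x. x \<in> {a..b} \<Longrightarrow> f x \<le> f c"
    using continuous_attains_sup[of "{a..b}" f] \<open>a \<le> b\<close> by auto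
  have "a < b" using \<open>a \<le> b\<close> neg \<open>f' a > 0\<close> by (cases "a = b") auto
  have "c \<noteq> a"
  proof
    assume "c = a"
    obtain d where d: "d > 0" "\<And>h. 0 < h \<Longrightarrow> h < d \<Longrightarrow> f a < f (a + h)"
      using DERIV_pos_inc_right[OF der[of a] \<open>f' a > 0\<close>] \<open>a \<le> b\<close> by auto
    define h where "h = min (d / 2) (b - a)"
    have "0 < h" "h < d" "a + h \<in> {a..b}" using \<open>d > 0\<close> \<open>a < b\<close> by (auto simp: h_def min_def)
    with d(2)[of h] c(2)[of "a + h"] \<open>c = a\<close> show False by auto
  qed
  moreover have "c \<noteq> b"
  proof
    assume "c = b"
    obtain d where d: "d > 0" "\<And>h. 0 < h \<Longrightarrow> h < d \<Longrightarrow> f b < f (b - h)"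
      using DERIV_neg_dec_left[OF der[of b] neg] \<open>a \<le> b\<close> by auto
    define h where "h = min (d / 2) (b - a)"
    have "0 < h" "h < d" "b - h \<in> {a..b}" using \<open>d > 0\<close> \<open>a < b\<close> by (auto simp: h_def min_def)
    with d(2)[of h] c(2)[of "b - h"] \<open>c = b\<close> show False by auto
  qed
  ultimately have "a < c" "c < b" using c(1) by auto
  then have "f' c = 0"
    using DERIV_local_max[OF der[OF c(1)], of "min (c - a) (b - c)"] c(2) by (auto simp: abs_if)
  with nz c(1) show False by blast
qed

text \<open>No continuity of \<open>f'\<close> is assumed, because this is applied to
  \<open>deriv \<Delta>\<close> before that function is known to be continuous. Negative values
  reduce to positive ones by passing to \<open>- f\<close>.\<close>

lemma derivative_nonzero_sgn:
  fixes f f' :: "real \<Rightarrow> real"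
  assumes "connected S" "x \<in> S" "y \<in> S"
    and der: "\<And>t. t \<in> S \<Longrightarrow> (f has_real_derivative f' t) (at t)"
    and nz: "\<And>t. t \<in> S \<Longrightarrow> f' t \<noteq> 0"
  shows "sgn (f' x) = sgn (f' y)"
proof -
  have main: "sgn (f' u) = sgn (f' v)" if "u \<le> v" "u \<in> S" "v \<in> S" for u v
  proof -
    have "{u..v} \<subseteq> S" by (rule connected_contains_Icc) (use that assms in auto)
    then have der': "(f has_real_derivative f' t) (at t)"
      and nz': "f' t \<noteq> 0" if "t \<in> {u..v}" for t
      using that der nz by auto
    consider "f' u > 0" | "- f' u > 0" using nz[OF \<open>u \<in> S\<close>] by linarith
    then show ?thesis
    proof cases
      case 1
      then show ?thesis using derivative_nonzero_pos[of u v f f'] der' nz' \<open>u \<le> v\<close> by auto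
    next
      case 2
      have "- f' v > 0"
        by (rule derivative_nonzero_pos[of u v "\<lambda>t. - f t" "\<lambda>t. - f' t"])
          (use 2 der' nz' \<open>u \<le> v\<close> in \<open>auto intro!: derivative_eq_intros\<close>)
      with 2 show ?thesis by auto
    qed
  qed
  show ?thesis using main[of x y] main[of y x] assms(2,3) linear[of x y] by metis
qed

lemma solves_on_DERIV:
  assumes "solves_on \<beta> C \<Delta> J" "t \<in> J"
  shows "(\<Delta> has_real_derivative deriv \<Delta> t) (at t)"
    and "(deriv \<Delta> t)\<^sup>2 = C * (\<Delta> t)\<^sup>2 - 2 * \<beta> * \<Delta> t"
  using assms by (auto simp: solves_on_def DERIV_deriv_iff_real_differentiable)

text \<open>A derivative has the intermediate value property, so near a regular point the sign
  of the square root cannot change.\<close>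

lemma second_order_equation:
  assumes J: "open J" "solves_on \<beta> C \<Delta> J" "t \<in> J" "deriv \<Delta> t \<noteq> 0"
  shows "(deriv \<Delta> has_real_derivative C * \<Delta> t - \<beta>) (at t)"
proof -
  define q where "q s = C * (\<Delta> s)\<^sup>2 - 2 * \<beta> * \<Delta> s" for s
  note D = solves_on_DERIV[OF J(2)]
  have q: "q s = (deriv \<Delta> s)\<^sup>2" if "s \<in> J" for s using D(2)[OF that] by (simp add: q_def)
  have "q t > 0" using q J by simp
  have "continuous_on J \<Delta>"
    using D(1) by (meson continuous_at_imp_continuous_on DERIV_isCont)
  then have "continuous_on J q" unfolding q_def by (intro continuous_intros)
  then have "open {s \<in> J. q s > 0}"
    using continuous_open_preimage[of J q "{0<..}"] \<open>open J\<close> by (auto simp: vimage_def Int_def)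
  then obtain r where r: "r > 0" "ball t r \<subseteq> {s \<in> J. q s > 0}"
    using \<open>q t > 0\<close> \<open>t \<in> J\<close> by (metis (mono_tags, lifting) mem_Collect_eq openE)
  \<comment> \<open>On this ball \<open>deriv \<Delta>\<close> is one fixed sign times
    \<open>sqrt (q s)\<close>, and the latter is differentiable because \<open>q\<close> is positive
    there.\<close>
  have root: "sgn (deriv \<Delta> t) * sqrt (q s) = deriv \<Delta> s" if "s \<in> ball t r" for s
  proof -
    have "s \<in> J" using that r by auto
    have "sgn (deriv \<Delta> t) = sgn (deriv \<Delta> s)"
    proof (rule derivative_nonzero_sgn[of "ball t r" _ _ \<Delta> "deriv \<Delta>"])
      fix u assume "u \<in> ball t r"
      with r have "u \<in> J" "q u > 0" by auto
      then show "(\<Delta> has_real_derivative deriv \<Delta> u) (at u)" "deriv \<Delta> u \<noteq> 0"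
        using D(1) q by auto
    qed (use that r in auto)
    then show ?thesis using q[OF \<open>s \<in> J\<close>] by (simp add: sgn_mult_abs)
  qed
  have "(q has_real_derivative C * (2 * \<Delta> t * deriv \<Delta> t) - 2 * \<beta> * deriv \<Delta> t) (at t)"
    unfolding q_def by (rule derivative_eq_intros D(1)[OF \<open>t \<in> J\<close>] refl)+ simp
  from DERIV_cmult[OF DERIV_chain2[OF DERIV_real_sqrt[OF \<open>q t > 0\<close>] this], of "sgn (deriv \<Delta> t)"]
  have "((\<lambda>s. sgn (deriv \<Delta> t) * sqrt (q s)) has_real_derivative
      sgn (deriv \<Delta> t) * ((C * (2 * \<Delta> t * deriv \<Delta> t) - 2 * \<beta> * deriv \<Delta> t) / (2 * sqrt (q t)))) (at t)"
    by (simp add: field_simps)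
  \<comment> \<open>The derivative of \<open>q\<close> is
    \<open>2 * (C * \<Delta> - \<beta>) * deriv \<Delta>\<close>, and
    \<open>sgn (deriv \<Delta> t) * sqrt (q t)\<close> equals \<open>deriv \<Delta> t\<close>, so
    the nonzero factor \<open>deriv \<Delta> t\<close> cancels.\<close>
  moreover have "sgn (deriv \<Delta> t) * ((C * (2 * \<Delta> t * deriv \<Delta> t) - 2 * \<beta> * deriv \<Delta> t) / (2 * sqrt (q t)))
      = C * \<Delta> t - \<beta>"
  proof -
    have "sqrt (q t) = \<bar>deriv \<Delta> t\<bar>" using q[OF \<open>t \<in> J\<close>] by simp
    then show ?thesis using J(4) by (simp add: field_simps sgn_if)
  qed
  ultimately have "((\<lambda>s. sgn (deriv \<Delta> t) * sqrt (q s)) has_real_derivative C * \<Delta> t - \<beta>) (at t)"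
    by simp
  then show ?thesis
    by (rule has_field_derivative_transform_within_open[of _ _ _ "ball t r"]) (use r root in auto)
qed

text \<open>At a critical point the absolute value of \<open>deriv \<Delta>\<close> is the square
  root of a continuous function vanishing there, so it tends to 0 whatever the signs do; elsewhere
  \<open>deriv \<Delta>\<close> is even differentiable. This covers the point where the second-order
  equation is missing.\<close>

lemma continuous_on_deriv_solution:
  assumes "open J" "solves_on \<beta> C \<Delta> J"
  shows "continuous_on J (deriv \<Delta>)"
proof (rule continuous_at_imp_continuous_on, rule ballI)
  fix t assume "t \<in> J"
  show "isCont (deriv \<Delta>) t"
  proof (cases "deriv \<Delta> t = 0")
    case False
    then show ?thesis using second_order_equation[OF assms \<open>t \<in> J\<close>] DERIV_isCont by blast
  next
    case True
    note D = solves_on_DERIV[OF assms(2)]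
    have "isCont \<Delta> t" using D(1)[OF \<open>t \<in> J\<close>] by (rule DERIV_isCont)
    then have "isCont (\<lambda>s. sqrt (C * (\<Delta> s)\<^sup>2 - 2 * \<beta> * \<Delta> s)) t" by (intro continuous_intros)
    then have "((\<lambda>s. sqrt (C * (\<Delta> s)\<^sup>2 - 2 * \<beta> * \<Delta> s)) \<longlongrightarrow> 0) (at t)"
      using D(2)[OF \<open>t \<in> J\<close>] True by (simp add: isCont_def)
    moreover have "eventually (\<lambda>s. sqrt (C * (\<Delta> s)\<^sup>2 - 2 * \<beta> * \<Delta> s) = \<bar>deriv \<Delta> s\<bar>) (at t)"
      using eventually_at_in_open'[OF \<open>open J\<close> \<open>t \<in> J\<close>]
    proof eventually_elim
      case (elim s)
      then show ?case using D(2)[OF elim, symmetric] by simp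
    qed
    ultimately have "((\<lambda>s. \<bar>deriv \<Delta> s\<bar>) \<longlongrightarrow> 0) (at t)"
      by (simp add: tendsto_cong)
    then show ?thesis using True by (simp add: isCont_def tendsto_rabs_zero_iff)
  qed
qed

section \<open>Vanishing initial data for w'' = C w\<close>

text \<open>A Gronwall argument: the damped energy \<open>E\<close> is nonnegative, starts at 0 and
  does not increase. Monotonicity needs the derivative only in the open interval, so the equation
  for \<open>v\<close> may be dropped at \<open>a\<close>, which will be the critical point.\<close>

lemma linear_ode_zero_aux:
  fixes w v :: "real \<Rightarrow> real"
  assumes "a \<le> b"
    and w: "\<And>t. t \<in> {a..b} \<Longrightarrow> (w has_real_derivative v t) (at t)"
    and v: "\<And>t. a < t \<Longrightarrow> t \<le> b \<Longrightarrow> (v has_real_derivative C * w t) (at t)"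
    and cont: "continuous_on {a..b} v"
    and "w a = 0" "v a = 0"
  shows "w b = 0"
proof -
  \<comment> \<open>The derivative of \<open>E\<close> has the factor
    \<open>2 * (C + 1) * w * v - m * (w^2 + v^2)\<close>; since \<open>2 * w * v\<close> is at most
    \<open>w^2 + v^2\<close> in absolute value, this \<open>m\<close> makes it nonpositive.\<close>
  define m where "m = \<bar>C + 1\<bar>"
  define E where "E t = ((w t)\<^sup>2 + (v t)\<^sup>2) * exp (- m * t)" for t
  have "E b \<le> E a"
  proof (rule DERIV_nonpos_imp_decreasing_open[OF \<open>a \<le> b\<close>])
    fix t assume t: "a < t" "t < b"
    have w': "(w has_real_derivative v t) (at t)" and v': "(v has_real_derivative C * w t) (at t)"
      using t w v by auto
    have "(E has_real_derivative
        (2 * (C + 1) * (w t * v t) - m * ((w t)\<^sup>2 + (v t)\<^sup>2)) * exp (- m * t)) (at t)"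
      unfolding E_def
      by (rule derivative_eq_intros w' v' refl)+ (simp add: algebra_simps)
    moreover have "2 * (C + 1) * (w t * v t) - m * ((w t)\<^sup>2 + (v t)\<^sup>2) \<le> 0"
    proof -
      have "2 * (C + 1) * (w t * v t) \<le> m * \<bar>2 * (w t * v t)\<bar>"
        unfolding m_def by (metis abs_ge_self abs_mult mult.assoc mult.left_commute)
      also have "\<dots> \<le> m * ((w t)\<^sup>2 + (v t)\<^sup>2)"
      proof (rule mult_left_mono)
        have "0 \<le> (w t + v t)\<^sup>2" "0 \<le> (w t - v t)\<^sup>2" by simp_all
        then show "\<bar>2 * (w t * v t)\<bar> \<le> (w t)\<^sup>2 + (v t)\<^sup>2"
          unfolding power2_sum power2_diff by linarith
      qed (simp add: m_def)
      finally show ?thesis by simp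
    qed
    ultimately show "\<exists>y. (E has_real_derivative y) (at t) \<and> y \<le> 0"
      by (metis exp_ge_zero mult_nonpos_nonneg)
  next
    have "continuous_on {a..b} w"
      using w by (meson continuous_at_imp_continuous_on DERIV_isCont)
    then show "continuous_on {a..b} E" unfolding E_def by (intro continuous_intros cont)
  qed
  then have "(w b)\<^sup>2 + (v b)\<^sup>2 \<le> 0" using assms(5,6) by (simp add: E_def mult_le_0_iff)
  then show ?thesis by (metis sum_power2_le_zero_iff)
qed

lemma linear_ode_zero:
  fixes w v :: "real \<Rightarrow> real"
  assumes J: "connected J" "a \<in> J" "b \<in> J"
    and w: "\<And>t. t \<in> J \<Longrightarrow> (w has_real_derivative v t) (at t)"
    and v: "\<And>t. t \<in> J \<Longrightarrow> t \<noteq> a \<Longrightarrow> (v has_real_derivative C * w t) (at t)"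
    and cont: "continuous_on J v"
    and "w a = 0" "v a = 0"
  shows "w b = 0"
proof (cases "a \<le> b")
  case True
  have "{a..b} \<subseteq> J" by (rule connected_contains_Icc) (use J in auto)
  with True show ?thesis
    by (intro linear_ode_zero_aux[of a b w v C] w v continuous_on_subset[OF cont])
      (use assms(7,8) in auto)
next
  case False
  have "{b..a} \<subseteq> J" by (rule connected_contains_Icc) (use J in auto)
  \<comment> \<open>To the left of \<open>a\<close> time is reversed: the equation is invariant
    under \<open>t\<close> to \<open>- t\<close>, with \<open>v\<close> changing sign.\<close>
  have "w (- (- b)) = 0"
  proof (rule linear_ode_zero_aux[of "- a" "- b" "\<lambda>t. w (- t)" "\<lambda>t. - v (- t)" C])
    fix t assume "t \<in> {- a..- b}"
    then have "- t \<in> J" using \<open>{b..a} \<subseteq> J\<close> by auto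
    then show "((\<lambda>t. w (- t)) has_real_derivative - v (- t)) (at t)"
      using w DERIV_mirror by blast
  next
    fix t assume "- a < t" "t \<le> - b"
    then have "- t \<in> {b..a}" "- t \<noteq> a" by auto
    then have "(v has_real_derivative C * w (- t)) (at (- t))" using v \<open>{b..a} \<subseteq> J\<close> by auto
    then show "((\<lambda>t. - v (- t)) has_real_derivative C * w (- t)) (at t)"
      using DERIV_minus DERIV_mirror minus_minus by metis
  next
    show "continuous_on {- a..- b} (\<lambda>t. - v (- t))"
      by (intro continuous_intros continuous_on_compose2[OF cont]) (use \<open>{b..a} \<subseteq> J\<close> in auto)
  qed (use False assms(7,8) in auto)
  then show ?thesis by simp
qed

text \<open>Between two critical points \<open>\<Delta>\<close> has no interior extremum other than the singular value
  \<open>2 * \<beta> / C\<close>, hence is constant there.\<close>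

lemma critical_point_unique:
  assumes sol: "positive_solution \<beta> C \<Delta> J" and ns: "nonsingular \<beta> C \<Delta> J"
    and nz: "C \<noteq> 0 \<or> \<beta> \<noteq> 0"
    and crit: "t \<in> J" "deriv \<Delta> t = 0" "u \<in> J" "deriv \<Delta> u = 0"
  shows "t = u"
proof -
  have J: "connected J" "solves_on \<beta> C \<Delta> J" and pos: "\<And>t. t \<in> J \<Longrightarrow> \<Delta> t > 0"
    using sol by (auto simp: positive_solution_def)
  note D = solves_on_DERIV[OF J(2)]
  have crit_eq: "C * \<Delta> s = 2 * \<beta>" if "s \<in> J" "deriv \<Delta> s = 0" for s
  proof -
    have "\<Delta> s * (C * \<Delta> s - 2 * \<beta>) = 0"
      using D(2)[OF that(1)] that(2) by (auto simp: power2_eq_square algebra_simps)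
    then show ?thesis using pos[OF that(1)] by simp
  qed
  \<comment> \<open>With \<open>C = 0\<close> a critical point would force
    \<open>\<beta> = 0\<close>, the excluded constant regime.\<close>
  have "C \<noteq> 0" using crit_eq[OF crit(1,2)] nz by auto
  have val: "\<Delta> s = 2 * \<beta> / C" if "s \<in> J" "deriv \<Delta> s = 0" for s
    using crit_eq[OF that] \<open>C \<noteq> 0\<close> by (simp add: field_simps)
  have main: False if "a < b" "a \<in> J" "b \<in> J" "deriv \<Delta> a = 0" "deriv \<Delta> b = 0" for a b
  proof -
    have sub: "{a..b} \<subseteq> J" by (rule connected_contains_Icc) (use J that in auto)
    have cont: "continuous_on {a..b} \<Delta>"
      using D(1) sub by (meson continuous_at_imp_continuous_on DERIV_isCont subsetD)
    obtain c where c: "c \<in> {a..b}" "\<And>x. x \<in> {a..b} \<Longrightarrow> \<Delta> x \<le> \<Delta> c"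
      using continuous_attains_sup[OF _ _ cont] \<open>a < b\<close> by auto
    obtain d where d: "d \<in> {a..b}" "\<And>x. x \<in> {a..b} \<Longrightarrow> \<Delta> d \<le> \<Delta> x"
      using continuous_attains_inf[OF _ _ cont] \<open>a < b\<close> by auto
    \<comment> \<open>An extremum at an endpoint is critical by assumption, an interior one by
      Fermat; in both cases its value is \<open>2 * \<beta> / C\<close>, so maximum and minimum
      coincide.\<close>
    have "deriv \<Delta> c = 0"
    proof (cases "c = a \<or> c = b")
      case False
      show ?thesis
        by (rule DERIV_local_max[OF D(1), of _ "min (c - a) (b - c)"])
          (use False c sub in \<open>auto simp: abs_if\<close>)
    qed (use that in auto)
    moreover have "deriv \<Delta> d = 0"
    proof (cases "d = a \<or> d = b")
      case False
      show ?thesis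
        by (rule DERIV_local_min[OF D(1), of _ "min (d - a) (b - d)"])
          (use False d sub in \<open>auto simp: abs_if\<close>)
    qed (use that in auto)
    ultimately have "\<Delta> c = 2 * \<beta> / C" "\<Delta> d = 2 * \<beta> / C" using val c(1) d(1) sub by blast+
    then have "\<forall>x\<in>{a<..<b}. \<Delta> x = 2 * \<beta> / C"
      using c(2) d(2) by (intro ballI order.antisym) auto
    moreover have "{a<..<b} \<subseteq> J" using sub by auto
    ultimately show False using ns \<open>C \<noteq> 0\<close> \<open>a < b\<close> unfolding nonsingular_def by blast
  qed
  show ?thesis using main[of t u] main[of u t] crit by (meson linorder_neqE)
qed

text \<open>The point \<open>a\<close> depends on \<open>\<Delta>\<close> alone and is fixed before
  \<open>G\<close>, so that a comparison curve may be selected afterwards by its data at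
  \<open>a\<close>. The inhomogeneous terms \<open>\<beta>\<close> cancel in
  \<open>\<Delta> - G\<close>.\<close>

lemma positive_solution_unique:
  assumes sol: "positive_solution \<beta> C \<Delta> J" and ns: "nonsingular \<beta> C \<Delta> J"
  obtains a where "a \<in> J"
    "\<And>G G' t. \<lbrakk>\<And>t. (G has_real_derivative G' t) (at t);
       \<And>t. (G' has_real_derivative C * G t - \<beta>) (at t);
       G a = \<Delta> a; G' a = deriv \<Delta> a; t \<in> J\<rbrakk> \<Longrightarrow> \<Delta> t = G t"
proof -
  have J: "open J" "connected J" "J \<noteq> {}" "solves_on \<beta> C \<Delta> J"
    using sol by (auto simp: positive_solution_def)
  note D = solves_on_DERIV[OF J(4)]
  obtain a where "a \<in> J" and
    ode: "\<And>t. t \<in> J \<Longrightarrow> t \<noteq> a \<Longrightarrow> (deriv \<Delta> has_real_derivative C * \<Delta> t - \<beta>) (at t)"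
  proof (cases "C = 0 \<and> \<beta> = 0")
    \<comment> \<open>Here every point is critical, but \<open>deriv \<Delta>\<close> vanishes
      identically, so the second-order equation holds trivially.\<close>
    case True
    then have 0: "deriv \<Delta> t = 0" if "t \<in> J" for t using D(2)[OF that] by simp
    have "(deriv \<Delta> has_real_derivative 0) (at t)" if "t \<in> J" for t
      by (rule has_field_derivative_transform_within_open[of "\<lambda>_. 0" _ _ J]) (use that J 0 in auto)
    then show ?thesis using that J(3) True by auto
  next
    case False
    \<comment> \<open>\<open>a\<close> is the critical point if one exists, and any point of
      \<open>J\<close> otherwise.\<close>
    obtain a where a: "a \<in> J" "\<And>t. t \<in> J \<Longrightarrow> t \<noteq> a \<Longrightarrow> deriv \<Delta> t \<noteq> 0"
      using critical_point_unique[OF sol ns] False J(3) by (metis ex_in_conv)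
    then show ?thesis using that second_order_equation[OF J(1,4)] by blast
  qed
  show thesis
  proof (rule that[OF \<open>a \<in> J\<close>])
    fix G G' :: "real \<Rightarrow> real" and t
    assume G: "\<And>t. (G has_real_derivative G' t) (at t)"
      "\<And>t. (G' has_real_derivative C * G t - \<beta>) (at t)" "G a = \<Delta> a" "G' a = deriv \<Delta> a" "t \<in> J"
    have "continuous_on J G'"
      using G(2) by (meson continuous_at_imp_continuous_on DERIV_isCont)
    then have "\<Delta> t - G t = 0"
      by (intro linear_ode_zero[of J a t "\<lambda>t. \<Delta> t - G t" "\<lambda>t. deriv \<Delta> t - G' t" C] J \<open>a \<in> J\<close>
          continuous_intros continuous_on_deriv_solution[OF J(1,4)])
        (use G D(1) ode in \<open>auto intro!: derivative_eq_intros simp: algebra_simps\<close>)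
    then show "\<Delta> t = G t" by simp
  qed
qed

section \<open>Families given by their initial values\<close>

text \<open>What the explicit families have in common. For fixed \<open>t\<close> the data
  \<open>(d, e)\<close> of a solution lie on the conic
  \<open>e^2 = C * d^2 - 2 * \<beta> * d\<close>; \<open>initial_value\<close> says that every point
  of it with \<open>d > 0\<close> is the data at \<open>t\<close> of exactly one curve. The
  conditions \<open>interval\<close>, \<open>pos\<close>, \<open>boundary\<close> and
  \<open>cover\<close> encode that \<open>\<I> p\<close> consists of the components of positivity of
  \<open>F p\<close>.\<close>

locale solution_curves =
  fixes \<beta> C :: real and P :: "'p set" and F F' :: "'p \<Rightarrow> real \<Rightarrow> real" and \<I> :: "'p \<Rightarrow> real set set"
  assumes deriv1: "\<And>p t. p \<in> P \<Longrightarrow> (F p has_real_derivative F' p t) (at t)"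
    and deriv2: "\<And>p t. p \<in> P \<Longrightarrow> (F' p has_real_derivative C * F p t - \<beta>) (at t)"
    and first_integral: "\<And>p t. p \<in> P \<Longrightarrow> (F' p t)\<^sup>2 = C * (F p t)\<^sup>2 - 2 * \<beta> * F p t"
    and intervals_nonempty: "\<And>p. p \<in> P \<Longrightarrow> \<I> p \<noteq> {}"
    and interval: "\<And>p J. p \<in> P \<Longrightarrow> J \<in> \<I> p \<Longrightarrow> open J \<and> connected J \<and> J \<noteq> {}"
    and pos: "\<And>p J t. p \<in> P \<Longrightarrow> J \<in> \<I> p \<Longrightarrow> t \<in> J \<Longrightarrow> F p t > 0"
    and boundary: "\<And>p J t. p \<in> P \<Longrightarrow> J \<in> \<I> p \<Longrightarrow> t \<in> closure J \<Longrightarrow> t \<notin> J \<Longrightarrow> F p t = 0"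
    and cover: "\<And>p t. p \<in> P \<Longrightarrow> F p t > 0 \<Longrightarrow> \<exists>J\<in>\<I> p. t \<in> J"
    and initial_value: "\<And>t d e. d > 0 \<Longrightarrow> e\<^sup>2 = C * d\<^sup>2 - 2 * \<beta> * d \<Longrightarrow>
      \<exists>!p. p \<in> P \<and> F p t = d \<and> F' p t = e"
begin

lemma solves: "p \<in> P \<Longrightarrow> solves_on \<beta> C (F p) S"
  unfolding solves_on_def
  using deriv1[of p] first_integral[of p] DERIV_imp_deriv[OF deriv1[of p]]
  by (auto simp: real_differentiable_def)

lemma positive: "p \<in> P \<Longrightarrow> J \<in> \<I> p \<Longrightarrow> positive_solution \<beta> C (F p) J"
  using interval pos solves by (auto simp: positive_solution_def)

text \<open>The singular constant violates the second-order equation: where \<open>F p\<close> is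
  constantly \<open>2 * \<beta> / C\<close>, that equation gives \<open>C * F p = \<beta>\<close>,
  hence \<open>\<beta> = 0\<close> and \<open>F p = 0\<close>, against positivity.\<close>

lemma nonsingular_curve:
  assumes "p \<in> P" "J \<in> \<I> p"
  shows "nonsingular \<beta> C (F p) J"
  unfolding nonsingular_def
proof (rule ccontr, clarify)
  fix a b
  assume "C \<noteq> 0" and ab: "a < b" "{a<..<b} \<subseteq> J" "\<forall>t\<in>{a<..<b}. F p t = 2 * \<beta> / C"
  have F'0: "F' p t = 0" if "t \<in> {a<..<b}" for t
  proof -
    have "(F p has_real_derivative 0) (at t)"
      by (rule has_field_derivative_transform_within_open[of "\<lambda>_. 2 * \<beta> / C" _ _ "{a<..<b}"])
        (use that ab in auto)
    then show ?thesis using deriv1[OF \<open>p \<in> P\<close>] DERIV_unique by blast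
  qed
  define c where "c = (a + b) / 2"
  have c: "c \<in> {a<..<b}" using \<open>a < b\<close> by (simp add: c_def field_simps)
  have "(F' p has_real_derivative 0) (at c)"
    by (rule has_field_derivative_transform_within_open[of "\<lambda>_. 0" _ _ "{a<..<b}"])
      (use c F'0 in auto)
  then have "C * F p c - \<beta> = 0" using deriv2[OF \<open>p \<in> P\<close>] DERIV_unique by blast
  then have "F p c = 0" using ab(3) c \<open>C \<noteq> 0\<close> by simp
  then show False using pos[OF assms, of c] ab(2) c by auto
qed

text \<open>A positive solution cannot leave \<open>J\<close>, since by continuity it would vanish at the boundary point
  where it does.\<close>

lemma contained:
  assumes "p \<in> P" "J \<in> \<I> p" and sol: "positive_solution \<beta> C D K"
    and "K \<inter> J \<noteq> {}" and eq: "\<And>t. t \<in> K \<inter> J \<Longrightarrow> D t = F p t"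
  shows "K \<subseteq> J"
proof (rule ccontr)
  have K: "open K" "connected K" "solves_on \<beta> C D K" and Dpos: "\<And>t. t \<in> K \<Longrightarrow> D t > 0"
    using sol by (auto simp: positive_solution_def)
  have "open J" using interval assms(1,2) by blast
  assume "\<not> K \<subseteq> J"
  then have "K \<inter> frontier J \<noteq> {}"
    using connected_Int_frontier[OF K(2) \<open>K \<inter> J \<noteq> {}\<close>] by blast
  then obtain x where x: "x \<in> K" "x \<in> closure J" "x \<notin> J"
    using \<open>open J\<close> by (auto simp: frontier_def interior_open)
  have "F p x = 0" using boundary assms(1,2) x by blast
  have "continuous_on K D" "continuous_on K (F p)"
    using solves_on_DERIV(1)[OF K(3)] deriv1[OF \<open>p \<in> P\<close>]
    by (meson continuous_at_imp_continuous_on DERIV_isCont)+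
  then have "continuous_on K (\<lambda>t. D t - F p t)" by (intro continuous_intros)
  \<comment> \<open>The set where \<open>D > F p\<close> is an open neighbourhood of
    \<open>x\<close>, since \<open>F p x = 0 < D x\<close>. As \<open>x\<close> is in the closure of
    \<open>J\<close>, that set meets \<open>J\<close>, where the two functions agree.\<close>
  then have "open (K \<inter> (\<lambda>t. D t - F p t) -` {0<..})"
    using K(1) by (intro continuous_open_preimage) auto
  moreover have "x \<in> K \<inter> (\<lambda>t. D t - F p t) -` {0<..}"
    using x Dpos \<open>F p x = 0\<close> by auto
  ultimately have "K \<inter> (\<lambda>t. D t - F p t) -` {0<..} \<inter> J \<noteq> {}"
    using open_Int_closure_eq_empty x(2) by blast
  then show False using eq by auto
qed

lemma maximal:
  assumes "p \<in> P" "J \<in> \<I> p"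
  shows "maximal_solution \<beta> C (F p) J"
  unfolding maximal_solution_def
proof (intro conjI positive nonsingular_curve assms notI)
  assume "\<exists>D I. J \<subset> I \<and> (\<forall>t\<in>J. D t = F p t) \<and> positive_solution \<beta> C D I"
  then obtain D I where I: "J \<subset> I" "\<forall>t\<in>J. D t = F p t" "positive_solution \<beta> C D I" by blast
  have "J \<noteq> {}" using interval assms by blast
  then have "I \<subseteq> J" by (intro contained[OF assms I(3)]) (use I in auto)
  with I(1) show False by blast
qed

text \<open>The data at the comparison point select \<open>p\<close>, and positivity confines
  \<open>J\<close> to a single interval of \<open>p\<close>. Maximality is not assumed, so this
  yields both the extension result and the classification.\<close>

lemma curve_through:
  assumes sol: "positive_solution \<beta> C \<Delta> J" "nonsingular \<beta> C \<Delta> J"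
  obtains p K where "p \<in> P" "K \<in> \<I> p" "J \<subseteq> K" "\<And>t. t \<in> J \<Longrightarrow> \<Delta> t = F p t"
proof -
  obtain a where a: "a \<in> J"
    "\<And>G G' t. \<lbrakk>\<And>t. (G has_real_derivative G' t) (at t);
       \<And>t. (G' has_real_derivative C * G t - \<beta>) (at t);
       G a = \<Delta> a; G' a = deriv \<Delta> a; t \<in> J\<rbrakk> \<Longrightarrow> \<Delta> t = G t"
    using positive_solution_unique[OF sol] by metis
  have J: "solves_on \<beta> C \<Delta> J" "\<Delta> a > 0" using sol(1) a(1) by (auto simp: positive_solution_def)
  obtain p where p: "p \<in> P" "F p a = \<Delta> a" "F' p a = deriv \<Delta> a"
    using initial_value[OF J(2) solves_on_DERIV(2)[OF J(1) a(1)]] by blast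
  have eq: "\<Delta> t = F p t" if "t \<in> J" for t
    using a(2)[OF deriv1[OF p(1)] deriv2[OF p(1)] p(2,3) that] .
  obtain K where K: "K \<in> \<I> p" "a \<in> K" using cover[OF p(1), of a] p(2) J(2) by auto
  have "J \<subseteq> K" by (rule contained[OF p(1) K(1) sol(1)]) (use a(1) K(2) eq in auto)
  then show thesis using that p(1) K(1) eq by blast
qed

lemma maximal_extension:
  assumes "positive_solution \<beta> C \<Delta> J" "nonsingular \<beta> C \<Delta> J"
  shows "\<exists>D I. J \<subseteq> I \<and> (\<forall>t\<in>J. D t = \<Delta> t) \<and> maximal_solution \<beta> C D I"
  using curve_through[OF assms] maximal by metis

lemma maximal_curve:
  assumes "maximal_solution \<beta> C \<Delta> J"
  obtains p where "p \<in> P" "J \<in> \<I> p" "\<And>t. t \<in> J \<Longrightarrow> \<Delta> t = F p t"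
proof -
  have sol: "positive_solution \<beta> C \<Delta> J" "nonsingular \<beta> C \<Delta> J"
    and max: "\<And>D I. J \<subset> I \<Longrightarrow> \<forall>t\<in>J. D t = \<Delta> t \<Longrightarrow> \<not> positive_solution \<beta> C D I"
    using assms unfolding maximal_solution_def by blast+
  obtain p K where p: "p \<in> P" "K \<in> \<I> p" "J \<subseteq> K" "\<And>t. t \<in> J \<Longrightarrow> \<Delta> t = F p t"
    using curve_through[OF sol] by metis
  have "J = K" using max[of K "F p"] positive[OF p(1,2)] p(3,4) by auto
  then show thesis using that p by blast
qed

theorem family: "solution_family \<beta> C P F \<I>"
  unfolding solution_family_def
proof (intro conjI ballI allI impI)
  fix p J assume "p \<in> P"
  then show "\<I> p \<noteq> {}" by (rule intervals_nonempty)
  assume "J \<in> \<I> p"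
  then show "maximal_solution \<beta> C (F p) J" using maximal \<open>p \<in> P\<close> by blast
next
  fix \<Delta> J assume max: "maximal_solution \<beta> C \<Delta> J"
  obtain p where p: "p \<in> P" "J \<in> \<I> p" "\<And>t. t \<in> J \<Longrightarrow> \<Delta> t = F p t"
    using maximal_curve[OF max] by blast
  show "\<exists>!p. p \<in> P \<and> J \<in> \<I> p \<and> (\<forall>t\<in>J. \<Delta> t = F p t)"
  proof (rule ex1I[of _ p])
    fix r assume r: "r \<in> P \<and> J \<in> \<I> r \<and> (\<forall>t\<in>J. \<Delta> t = F r t)"
    \<comment> \<open>Curves agreeing on the open set \<open>J\<close> share value and derivative at
      a point of it, hence have the same initial data.\<close>
    obtain t where t: "t \<in> J" "open J" using interval p(1,2) by blast
    have "(F r has_real_derivative F' p t) (at t)"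
      by (rule has_field_derivative_transform_within_open[of "F p" _ _ J]) (use deriv1 t p r in auto)
    then have "F' r t = F' p t" using deriv1 r DERIV_unique by blast
    moreover have "F r t = F p t" using r p(3) t by simp
    moreover have "\<exists>!u. u \<in> P \<and> F u t = F p t \<and> F' u t = F' p t"
      by (rule initial_value[OF pos[OF p(1,2) t(1)] first_integral[OF p(1)]])
    ultimately show "r = p" using r p(1) by blast
  qed (use p in auto)
next
  fix t1 d s :: real
  assume "d > 0 \<and> s \<in> {1, -1} \<and> C * d\<^sup>2 - 2 * \<beta> * d \<ge> 0"
  then have "d > 0" and "(s * sqrt (C * d\<^sup>2 - 2 * \<beta> * d))\<^sup>2 = C * d\<^sup>2 - 2 * \<beta> * d"
    by (auto simp: power_mult_distrib)
  then have "\<exists>!p. p \<in> P \<and> F p t1 = d \<and> F' p t1 = s * sqrt (C * d\<^sup>2 - 2 * \<beta> * d)"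
    by (rule initial_value)
  \<comment> \<open>Since \<open>d > 0\<close>, \<open>cover\<close> makes membership of
    \<open>t1\<close> in an interval automatic.\<close>
  moreover have "(p \<in> P \<and> (\<exists>J\<in>\<I> p. t1 \<in> J) \<and> F p t1 = d \<and>
        deriv (F p) t1 = s * sqrt (C * d\<^sup>2 - 2 * \<beta> * d)) \<longleftrightarrow>
      (p \<in> P \<and> F p t1 = d \<and> F' p t1 = s * sqrt (C * d\<^sup>2 - 2 * \<beta> * d))" for p
    using cover[of p t1] \<open>d > 0\<close> DERIV_imp_deriv[OF deriv1[of p t1]] by auto
  ultimately show "\<exists>!p. p \<in> P \<and> (\<exists>J\<in>\<I> p. t1 \<in> J) \<and> F p t1 = d \<and>
      deriv (F p) t1 = s * sqrt (C * d\<^sup>2 - 2 * \<beta> * d)"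
    by simp
qed

end

section \<open>The explicit solutions\<close>

text \<open>Supplies the phase of an oscillatory curve with given data, with
  \<open>\<theta> = k * t\<close>. Restricting \<open>\<phi>\<close> to one period makes it unique:
  two choices differ by a multiple of \<open>2 * pi\<close> smaller than
  \<open>2 * pi\<close>.\<close>

lemma circle_phase:
  fixes \<theta> x y :: real
  assumes "x\<^sup>2 + y\<^sup>2 = 1"
  shows "\<exists>!\<phi>. \<phi> \<in> {0..<2 * pi} \<and> cos (\<theta> + \<phi>) = x \<and> sin (\<theta> + \<phi>) = y"
proof (rule ex_ex1I)
  obtain \<psi> where \<psi>: "x = cos \<psi>" "y = sin \<psi>" using sincos_total_2pi[OF assms] by metis
  obtain \<phi> where "0 \<le> \<phi>" "\<phi> < 2 * pi" "cos (\<psi> - \<theta>) = cos \<phi>" "sin (\<psi> - \<theta>) = sin \<phi>"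
    using sincos_total_2pi[of "cos (\<psi> - \<theta>)" "sin (\<psi> - \<theta>)"] by (metis sin_cos_squared_add2)
  moreover from this have "cos (\<theta> + \<phi>) = cos (\<theta> + (\<psi> - \<theta>))" "sin (\<theta> + \<phi>) = sin (\<theta> + (\<psi> - \<theta>))"
    by (simp_all only: cos_add sin_add)
  ultimately show "\<exists>\<phi>. \<phi> \<in> {0..<2 * pi} \<and> cos (\<theta> + \<phi>) = x \<and> sin (\<theta> + \<phi>) = y"
    using \<psi> by auto
next
  fix \<phi> \<psi>
  assume *: "\<phi> \<in> {0..<2 * pi} \<and> cos (\<theta> + \<phi>) = x \<and> sin (\<theta> + \<phi>) = y"
    "\<psi> \<in> {0..<2 * pi} \<and> cos (\<theta> + \<psi>) = x \<and> sin (\<theta> + \<psi>) = y"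
  then obtain n :: int where n: "\<theta> + \<phi> = \<theta> + \<psi> + 2 * pi * n"
    by (metis sin_cos_eq_iff)
  then have "2 * pi * \<bar>real_of_int n\<bar> = \<bar>\<phi> - \<psi>\<bar>" by (simp add: abs_mult)
  also have "\<dots> < 2 * pi * 1" using * by auto
  finally have "\<bar>real_of_int n\<bar> < 1" by (rule mult_left_less_imp_less) simp
  then have "n = 0" by linarith
  with n show "\<phi> = \<psi>" by simp
qed

lemma cos_less_one:
  assumes "2 * pi * of_int n < x" "x < 2 * pi * (of_int n + 1)"
  shows "cos x < 1"
proof -
  have "cos x \<noteq> 1"
  proof
    assume "cos x = 1"
    then obtain m :: int where "x = of_int m * 2 * pi" using cos_one_2pi_int by blast
    with assms have "2 * pi * real_of_int n < 2 * pi * real_of_int m"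
      "2 * pi * real_of_int m < 2 * pi * (real_of_int n + 1)" by (simp_all add: mult_ac)
    from mult_left_less_imp_less[OF this(1)] mult_left_less_imp_less[OF this(2)]
    show False by simp
  qed
  then show ?thesis using cos_le_one[of x] by linarith
qed

lemma oscillation_derivs:
  fixes A k \<phi> t :: real
  shows "((\<lambda>t. A * (1 - cos (k * t + \<phi>))) has_real_derivative A * k * sin (k * t + \<phi>)) (at t)"
    and "((\<lambda>t. A * k * sin (k * t + \<phi>)) has_real_derivative
      - (k\<^sup>2) * (A * (1 - cos (k * t + \<phi>))) - - A * k\<^sup>2) (at t)"
    and "(A * k * sin (k * t + \<phi>))\<^sup>2 = - (k\<^sup>2) * (A * (1 - cos (k * t + \<phi>)))\<^sup>2
      - 2 * (- A * k\<^sup>2) * (A * (1 - cos (k * t + \<phi>)))"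
proof -
  show "((\<lambda>t. A * (1 - cos (k * t + \<phi>))) has_real_derivative A * k * sin (k * t + \<phi>)) (at t)"
    by (auto intro!: derivative_eq_intros)
  show "((\<lambda>t. A * k * sin (k * t + \<phi>)) has_real_derivative
      - (k\<^sup>2) * (A * (1 - cos (k * t + \<phi>))) - - A * k\<^sup>2) (at t)"
    by (auto intro!: derivative_eq_intros simp: power2_eq_square algebra_simps)
  show "(A * k * sin (k * t + \<phi>))\<^sup>2 = - (k\<^sup>2) * (A * (1 - cos (k * t + \<phi>)))\<^sup>2
      - 2 * (- A * k\<^sup>2) * (A * (1 - cos (k * t + \<phi>)))"
    by (simp add: power_mult_distrib sin_squared_eq) (simp add: power2_eq_square algebra_simps)
qed

text \<open>Stated for every phase, whereas the family below is parametrized by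
  \<open>{0..<2 * pi}\<close> only.\<close>

lemma oscillatory_solves:
  "solves_on (- A * k\<^sup>2) (- (k\<^sup>2)) (\<lambda>t. A * (1 - cos (k * t + \<phi>))) S"
  unfolding solves_on_def
proof (intro ballI conjI)
  fix t
  show "(\<lambda>t. A * (1 - cos (k * t + \<phi>))) differentiable at t"
    using oscillation_derivs(1) real_differentiable_def by blast
  show "(deriv (\<lambda>t. A * (1 - cos (k * t + \<phi>))) t)\<^sup>2 = - (k\<^sup>2) * (A * (1 - cos (k * t + \<phi>)))\<^sup>2
      - 2 * (- A * k\<^sup>2) * (A * (1 - cos (k * t + \<phi>)))"
    unfolding DERIV_imp_deriv[OF oscillation_derivs(1)] by (rule oscillation_derivs(3))
qed

lemma oscillatory_curves:
  fixes A k :: real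
  assumes "A > 0" "k > 0"
  shows "solution_curves (- A * k\<^sup>2) (- (k\<^sup>2)) {0..<2 * pi} (\<lambda>\<phi> t. A * (1 - cos (k * t + \<phi>)))
    (\<lambda>\<phi> t. A * k * sin (k * t + \<phi>))
    (\<lambda>\<phi>. range (\<lambda>n::int. {(2 * pi * of_int n - \<phi>) / k <..< (2 * pi * (of_int n + 1) - \<phi>) / k}))"
proof
  fix \<phi> t :: real
  show "((\<lambda>t. A * (1 - cos (k * t + \<phi>))) has_real_derivative A * k * sin (k * t + \<phi>)) (at t)"
    "((\<lambda>t. A * k * sin (k * t + \<phi>)) has_real_derivative
      - (k\<^sup>2) * (A * (1 - cos (k * t + \<phi>))) - - A * k\<^sup>2) (at t)"
    "(A * k * sin (k * t + \<phi>))\<^sup>2 = - (k\<^sup>2) * (A * (1 - cos (k * t + \<phi>)))\<^sup>2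
      - 2 * (- A * k\<^sup>2) * (A * (1 - cos (k * t + \<phi>)))"
    by (rule oscillation_derivs)+
next
  fix \<phi> J
  assume "J \<in> range (\<lambda>n::int. {(2 * pi * of_int n - \<phi>) / k <..< (2 * pi * (of_int n + 1) - \<phi>) / k})"
  then obtain n :: int where J: "J = {(2 * pi * of_int n - \<phi>) / k <..< (2 * pi * (of_int n + 1) - \<phi>) / k}"
    by blast
  have less: "(2 * pi * of_int n - \<phi>) / k < (2 * pi * (of_int n + 1) - \<phi>) / k"
    using \<open>k > 0\<close> by (intro divide_strict_right_mono) (auto simp: algebra_simps)
  then show "open J \<and> connected J \<and> J \<noteq> {}" by (auto simp: J)
  show "A * (1 - cos (k * t + \<phi>)) > 0" if "t \<in> J" for t
    using cos_less_one[of n "k * t + \<phi>"] that assms by (simp add: J field_simps)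
  show "A * (1 - cos (k * t + \<phi>)) = 0" if "t \<in> closure J" "t \<notin> J" for t
  proof -
    have "t = (2 * pi * of_int n - \<phi>) / k \<or> t = (2 * pi * of_int (n + 1) - \<phi>) / k"
      using that less by (auto simp: J)
    then obtain m :: int where "t = (2 * pi * of_int m - \<phi>) / k" by blast
    then have "k * t + \<phi> = of_int m * 2 * pi" using \<open>k > 0\<close> by (simp add: field_simps)
    then have "cos (k * t + \<phi>) = 1" using cos_one_2pi_int by blast
    then show ?thesis by simp
  qed
next
  fix \<phi> t assume gt: "A * (1 - cos (k * t + \<phi>)) > 0"
  define n where "n = \<lfloor>(k * t + \<phi>) / (2 * pi)\<rfloor>"
  \<comment> \<open>The floor gives only a weak lower bound; equality would put \<open>t\<close> at
    a zero of the curve.\<close>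
  have "(k * t + \<phi>) / (2 * pi) \<noteq> of_int n"
  proof
    assume "(k * t + \<phi>) / (2 * pi) = of_int n"
    then have "k * t + \<phi> = of_int n * 2 * pi" by (simp add: field_simps)
    then have "cos (k * t + \<phi>) = 1" using cos_one_2pi_int by blast
    with gt show False by simp
  qed
  then have "of_int n < (k * t + \<phi>) / (2 * pi)" "(k * t + \<phi>) / (2 * pi) < of_int n + 1"
    unfolding n_def by linarith+
  then have "t \<in> {(2 * pi * of_int n - \<phi>) / k <..< (2 * pi * (of_int n + 1) - \<phi>) / k}"
    using \<open>k > 0\<close> by (simp add: field_simps)
  then show "\<exists>J\<in>range (\<lambda>n::int. {(2 * pi * of_int n - \<phi>) / k <..< (2 * pi * (of_int n + 1) - \<phi>) / k}). t \<in> J"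
    by blast
next
  fix t d e :: real
  assume e: "e\<^sup>2 = - (k\<^sup>2) * d\<^sup>2 - 2 * (- A * k\<^sup>2) * d"
  \<comment> \<open>In the coordinates \<open>1 - d / A\<close> and \<open>e / (A * k)\<close>,
    which are the cosine and sine of the phase, the conic of initial data is the unit
    circle.\<close>
  have "(1 - d / A)\<^sup>2 + (e / (A * k))\<^sup>2 = 1"
    using assms by (simp add: power_divide e power_mult_distrib) (simp add: power2_eq_square field_simps)
  moreover have "A * (1 - cos (k * t + \<phi>)) = d \<longleftrightarrow> cos (k * t + \<phi>) = 1 - d / A"
    "A * k * sin (k * t + \<phi>) = e \<longleftrightarrow> sin (k * t + \<phi>) = e / (A * k)" for \<phi>
    using assms by (auto simp: field_simps)
  ultimately show "\<exists>!\<phi>. \<phi> \<in> {0..<2 * pi} \<and> A * (1 - cos (k * t + \<phi>)) = d \<and> A * k * sin (k * t + \<phi>) = e"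
    using circle_phase[of "1 - d / A" "e / (A * k)" "k * t"] by simp
qed auto

section \<open>Curves with C = 0\<close>

lemma parabolic_curves:
  fixes \<beta> :: real
  assumes "\<beta> < 0"
  shows "solution_curves \<beta> 0 UNIV (\<lambda>t0 t. \<bar>\<beta>\<bar> / 2 * (t - t0)\<^sup>2) (\<lambda>t0 t. - \<beta> * (t - t0))
    (\<lambda>t0. {{t0<..}, {..<t0}})"
proof
  fix t d e :: real
  assume "e\<^sup>2 = 0 * d\<^sup>2 - 2 * \<beta> * d"
  then have e: "d = - (e\<^sup>2) / (2 * \<beta>)" using assms by (simp add: field_simps)
  show "\<exists>!t0. t0 \<in> UNIV \<and> \<bar>\<beta>\<bar> / 2 * (t - t0)\<^sup>2 = d \<and> - \<beta> * (t - t0) = e"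
    \<comment> \<open>The slope condition alone gives this \<open>t0\<close>; the first integral
      then makes the value \<open>d\<close> correct.\<close>
    by (rule ex1I[of _ "t + e / \<beta>"]) (use assms in \<open>auto simp: e power2_eq_square field_simps\<close>)
next
  fix t0 t :: real
  show "((\<lambda>t. \<bar>\<beta>\<bar> / 2 * (t - t0)\<^sup>2) has_real_derivative - \<beta> * (t - t0)) (at t)"
    "((\<lambda>t. - \<beta> * (t - t0)) has_real_derivative 0 * (\<bar>\<beta>\<bar> / 2 * (t - t0)\<^sup>2) - \<beta>) (at t)"
    using assms by (auto intro!: derivative_eq_intros)
  show "(- \<beta> * (t - t0))\<^sup>2 = 0 * (\<bar>\<beta>\<bar> / 2 * (t - t0)\<^sup>2)\<^sup>2 - 2 * \<beta> * (\<bar>\<beta>\<bar> / 2 * (t - t0)\<^sup>2)"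
    using assms by (simp add: power_mult_distrib power2_eq_square)
next
  fix t0 t :: real
  assume "\<bar>\<beta>\<bar> / 2 * (t - t0)\<^sup>2 > 0"
  then have "t \<noteq> t0" by auto
  then show "\<exists>J\<in>{{t0<..}, {..<t0}}. t \<in> J" by auto
qed (use assms in \<open>auto intro!: mult_neg_pos\<close>)

lemma constant_curves:
  "solution_curves 0 0 {0<..} (\<lambda>\<Delta>0 t. \<Delta>0) (\<lambda>_ _. 0) (\<lambda>\<Delta>0. {UNIV})"
  by unfold_locales auto

section \<open>Curves with C > 0\<close>

lemma exponential_curves:
  fixes \<Delta>0 k :: real
  assumes "\<Delta>0 > 0" "k > 0"
  shows "solution_curves 0 (k\<^sup>2) ({1, -1} \<times> UNIV) (\<lambda>(\<sigma>, t0) t. \<Delta>0 * exp (\<sigma> * k * (t - t0)))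
    (\<lambda>(\<sigma>, t0) t. \<sigma> * k * (\<Delta>0 * exp (\<sigma> * k * (t - t0)))) (\<lambda>(\<sigma>, t0). {UNIV})"
proof
  fix t d e :: real
  assume "d > 0" "e\<^sup>2 = k\<^sup>2 * d\<^sup>2 - 2 * 0 * d"
  \<comment> \<open>For \<open>\<beta> = 0\<close> the conic degenerates into two lines;
    \<open>\<sigma>\<close> records which line carries the data.\<close>
  then have "e\<^sup>2 = (k * d)\<^sup>2" by (simp add: power_mult_distrib)
  then have "e = k * d \<or> e = - (k * d)" by (simp only: power2_eq_iff)
  then obtain \<sigma> where \<sigma>: "\<sigma> \<in> {1, -1}" "e = \<sigma> * k * d" by fastforce
  show "\<exists>!p. p \<in> {1, -1} \<times> UNIV \<and> (case p of (\<sigma>, t0) \<Rightarrow> \<lambda>t. \<Delta>0 * exp (\<sigma> * k * (t - t0))) t = d \<and>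
      (case p of (\<sigma>, t0) \<Rightarrow> \<lambda>t. \<sigma> * k * (\<Delta>0 * exp (\<sigma> * k * (t - t0)))) t = e"
  \<comment> \<open>Obtained by solving \<open>\<Delta>0 * exp (\<sigma> * k * (t - t0)) = d\<close>
    for \<open>t0\<close>, with \<open>1 / \<sigma> = \<sigma>\<close>. The amplitude
    \<open>\<Delta>0\<close> stays fixed because a time shift absorbs it.\<close>
  proof (rule ex1I[of _ "(\<sigma>, t - \<sigma> * ln (d / \<Delta>0) / k)"])
    show "(\<sigma>, t - \<sigma> * ln (d / \<Delta>0) / k) \<in> {1, -1} \<times> UNIV \<and>
      (case (\<sigma>, t - \<sigma> * ln (d / \<Delta>0) / k) of (\<sigma>, t0) \<Rightarrow> \<lambda>t. \<Delta>0 * exp (\<sigma> * k * (t - t0))) t = d \<and>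
      (case (\<sigma>, t - \<sigma> * ln (d / \<Delta>0) / k) of (\<sigma>, t0) \<Rightarrow>
        \<lambda>t. \<sigma> * k * (\<Delta>0 * exp (\<sigma> * k * (t - t0)))) t = e"
      using \<sigma> assms \<open>d > 0\<close> by auto
  next
    fix p assume *: "p \<in> {1, -1} \<times> UNIV \<and>
      (case p of (\<sigma>, t0) \<Rightarrow> \<lambda>t. \<Delta>0 * exp (\<sigma> * k * (t - t0))) t = d \<and>
      (case p of (\<sigma>, t0) \<Rightarrow> \<lambda>t. \<sigma> * k * (\<Delta>0 * exp (\<sigma> * k * (t - t0)))) t = e"
    obtain \<tau> u where p: "p = (\<tau>, u)" by fastforce
    from * p have \<tau>: "\<tau> \<in> {1, -1}" "\<Delta>0 * exp (\<tau> * k * (t - u)) = d" "\<tau> * k * d = e" by auto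
    have "\<tau> = \<sigma>" using \<tau>(3) \<sigma>(2) assms \<open>d > 0\<close> by simp
    have "exp (\<tau> * k * (t - u)) = d / \<Delta>0" using \<tau>(2) assms by (simp add: field_simps)
    then have "\<tau> * k * (t - u) = ln (d / \<Delta>0)" by (metis ln_exp)
    then show "p = (\<sigma>, t - \<sigma> * ln (d / \<Delta>0) / k)"
      using p \<open>\<tau> = \<sigma>\<close> \<tau>(1) \<open>k > 0\<close> by (auto simp: field_simps)
  qed
qed (use assms in \<open>auto intro!: derivative_eq_intros simp: power2_eq_square algebra_simps\<close>)

text \<open>With \<open>b = \<beta> / C\<close> the half-argument identities turn
  \<open>b + \<bar>b\<bar> * cosh (k * u)\<close> into \<open>2 * b * cosh^2 (k * u / 2)\<close> for
  \<open>b > 0\<close> and into \<open>- 2 * b * sinh^2 (k * u / 2)\<close> for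
  \<open>b < 0\<close>. This common form handles both regimes at once; only the intervals of
  positivity differ.\<close>

lemma hyperbolic_curves:
  fixes b k :: real
  assumes "b \<noteq> 0" "k > 0"
  shows "solution_curves (b * k\<^sup>2) (k\<^sup>2) UNIV (\<lambda>t0 t. b + \<bar>b\<bar> * cosh (k * (t - t0)))
    (\<lambda>t0 t. \<bar>b\<bar> * k * sinh (k * (t - t0)))
    (\<lambda>t0. if b < 0 then {{t0<..}, {..<t0}} else {UNIV})"
proof -
  have cosh_gt: "cosh (k * (t - t0)) > 1" if "t \<noteq> t0" for t t0
  proof -
    have "(cosh (k * (t - t0)))\<^sup>2 > 1\<^sup>2" using that assms by (simp add: cosh_square_eq)
    then show ?thesis by (rule power2_less_imp_less) simp
  qed
  have pos: "b + \<bar>b\<bar> * cosh (k * (t - t0)) > 0" if "b > 0 \<or> t \<noteq> t0" for t t0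
  proof (cases "b > 0")
    case True
    then show ?thesis by (simp add: add_pos_pos)
  next
    case False
    then have "\<bar>b\<bar> * 1 < \<bar>b\<bar> * cosh (k * (t - t0))"
      using cosh_gt that assms by (intro mult_strict_left_mono) auto
    with False show ?thesis by simp
  qed
  show ?thesis
  proof
    fix t0 t :: real
    show "((\<lambda>t. b + \<bar>b\<bar> * cosh (k * (t - t0))) has_real_derivative \<bar>b\<bar> * k * sinh (k * (t - t0))) (at t)"
      by (auto intro!: derivative_eq_intros)
    show "((\<lambda>t. \<bar>b\<bar> * k * sinh (k * (t - t0))) has_real_derivative
        k\<^sup>2 * (b + \<bar>b\<bar> * cosh (k * (t - t0))) - b * k\<^sup>2) (at t)"
      by (auto intro!: derivative_eq_intros simp: power2_eq_square algebra_simps)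
    show "(\<bar>b\<bar> * k * sinh (k * (t - t0)))\<^sup>2 =
        k\<^sup>2 * (b + \<bar>b\<bar> * cosh (k * (t - t0)))\<^sup>2 - 2 * (b * k\<^sup>2) * (b + \<bar>b\<bar> * cosh (k * (t - t0)))"
      by (simp add: power_mult_distrib sinh_square_eq power2_sum) (simp add: power2_eq_square algebra_simps)
  next
    fix t0 t :: real and J
    assume J: "J \<in> (if b < 0 then {{t0<..}, {..<t0}} else {UNIV})"
    then show "open J \<and> connected J \<and> J \<noteq> {}" by (auto split: if_splits)
    show "b + \<bar>b\<bar> * cosh (k * (t - t0)) > 0" if "t \<in> J"
      using J that assms by (intro pos) (auto split: if_splits)
    show "b + \<bar>b\<bar> * cosh (k * (t - t0)) = 0" if "t \<in> closure J" "t \<notin> J"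
      using J that assms by (auto split: if_splits)
  next
    fix t0 t :: real assume "b + \<bar>b\<bar> * cosh (k * (t - t0)) > 0"
    then have "b < 0 \<longrightarrow> t \<noteq> t0" by auto
    then show "\<exists>J\<in>if b < 0 then {{t0<..}, {..<t0}} else {UNIV}. t \<in> J" by auto
  next
    fix t d e :: real
    assume "d > 0" and e: "e\<^sup>2 = k\<^sup>2 * d\<^sup>2 - 2 * (b * k\<^sup>2) * d"
    have "e\<^sup>2 = k\<^sup>2 * (d * (d - 2 * b))" unfolding e by (simp add: power2_eq_square algebra_simps)
    then have "k\<^sup>2 * (d * (d - 2 * b)) \<ge> 0" by (metis zero_le_power2)
    then have "d \<ge> 2 * b" using \<open>d > 0\<close> assms by (simp add: zero_le_mult_iff)
    \<comment> \<open>The data lie on a hyperbola centred at \<open>d = b\<close>; positivity of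
      \<open>d\<close> selects the branch to the right of the centre.\<close>
    then have "d - b \<ge> 0" using \<open>d > 0\<close> by linarith
    \<comment> \<open>On this branch \<open>e\<close> determines \<open>d\<close>, so only the slope
      condition is left, and it has one solution \<open>t0\<close> because \<open>sinh\<close> is a
      bijection.\<close>
    have cosh_val: "b + \<bar>b\<bar> * cosh x = d" if x: "\<bar>b\<bar> * k * sinh x = e" for x
    proof -
      have "(\<bar>b\<bar> * cosh x)\<^sup>2 * k\<^sup>2 = (\<bar>b\<bar> * k * sinh x)\<^sup>2 + (b * k)\<^sup>2"
        by (simp add: power_mult_distrib cosh_square_eq algebra_simps)
      also have "\<dots> = (d - b)\<^sup>2 * k\<^sup>2" unfolding x e by (simp add: power2_eq_square algebra_simps)
      finally have "(\<bar>b\<bar> * cosh x)\<^sup>2 = (d - b)\<^sup>2"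
        by (rule mult_right_cancel[THEN iffD1, rotated]) (use assms in simp)
      then have "\<bar>b\<bar> * cosh x = d - b"
        by (rule power2_eq_imp_eq) (use \<open>d - b \<ge> 0\<close> in \<open>simp_all add: less_imp_le\<close>)
      then show ?thesis by simp
    qed
    have "\<bar>b\<bar> * k * sinh (k * (t - t0)) = e \<longleftrightarrow> sinh (k * (t - t0)) = e / (\<bar>b\<bar> * k)" for t0
      using assms by (auto simp: field_simps)
    moreover have "sinh (k * (t - t0)) = e / (\<bar>b\<bar> * k) \<longleftrightarrow> k * (t - t0) = arsinh (e / (\<bar>b\<bar> * k))" for t0
      by (metis arsinh_sinh_real sinh_arsinh_real)
    moreover have "k * (t - t0) = arsinh (e / (\<bar>b\<bar> * k)) \<longleftrightarrow> t0 = t - arsinh (e / (\<bar>b\<bar> * k)) / k" for t0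
      using assms by (auto simp: field_simps)
    ultimately have "\<exists>!t0. \<bar>b\<bar> * k * sinh (k * (t - t0)) = e" by simp
    moreover have "(t0 \<in> UNIV \<and> b + \<bar>b\<bar> * cosh (k * (t - t0)) = d \<and> \<bar>b\<bar> * k * sinh (k * (t - t0)) = e)
        \<longleftrightarrow> \<bar>b\<bar> * k * sinh (k * (t - t0)) = e" for t0
      using cosh_val by blast
    ultimately show "\<exists>!t0. t0 \<in> UNIV \<and> b + \<bar>b\<bar> * cosh (k * (t - t0)) = d \<and>
        \<bar>b\<bar> * k * sinh (k * (t - t0)) = e"
      by (simp only:)
  qed auto
qed

section \<open>Classification\<close>

text \<open>A single point of \<open>J\<close> suffices:
  \<open>\<Delta> t * (C * \<Delta> t - 2 * \<beta>)\<close> is a square, so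
  \<open>2 * \<beta> \<le> C * \<Delta> t\<close>, which rules out the remaining sign
  patterns.\<close>

lemma positive_solution_cases:
  assumes "positive_solution \<beta> C \<Delta> J"
  obtains "C < 0" "\<beta> < 0" | "C = 0" "\<beta> < 0" | "C = 0" "\<beta> = 0"
    | "C > 0" "\<beta> < 0" | "C > 0" "\<beta> = 0" | "C > 0" "\<beta> > 0"
proof -
  obtain t where t: "t \<in> J" "\<Delta> t > 0" "solves_on \<beta> C \<Delta> J"
    using assms unfolding positive_solution_def by blast
  have "\<Delta> t * (C * \<Delta> t - 2 * \<beta>) = (deriv \<Delta> t)\<^sup>2"
    using solves_on_DERIV(2)[OF t(3,1)] by (simp add: power2_eq_square algebra_simps)
  then have "\<Delta> t * (C * \<Delta> t - 2 * \<beta>) \<ge> 0" by simp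
  then have "2 * \<beta> \<le> C * \<Delta> t" using t(2) by (simp add: zero_le_mult_iff)
  moreover have "C < 0 \<Longrightarrow> C * \<Delta> t < 0" using t(2) by (simp add: mult_neg_pos)
  ultimately have "(C < 0 \<longrightarrow> \<beta> < 0) \<and> (C = 0 \<longrightarrow> \<beta> \<le> 0)" by auto
  then show thesis using that by linarith
qed

lemma occurs_unique: "occurs r \<beta> C \<Delta> J \<Longrightarrow> occurs r' \<beta> C \<Delta> J \<Longrightarrow> r = r'"
  by (cases r; cases r') auto

text \<open>Amplitude and rate come from solving \<open>\<beta> = - A * k^2\<close> and
  \<open>C = - (k^2)\<close>: \<open>A = \<beta> / C\<close>, \<open>k = sqrt (- C)\<close>.\<close>

lemma oscillatory_case:
  assumes "C < 0" "\<beta> < 0"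
  shows "solution_curves \<beta> C {0..<2 * pi} (\<lambda>\<phi> t. \<beta> / C * (1 - cos (sqrt (- C) * t + \<phi>)))
    (\<lambda>\<phi> t. \<beta> / C * sqrt (- C) * sin (sqrt (- C) * t + \<phi>))
    (\<lambda>\<phi>. range (\<lambda>n::int. {(2 * pi * of_int n - \<phi>) / sqrt (- C)
                        <..< (2 * pi * (of_int n + 1) - \<phi>) / sqrt (- C)}))"
  using oscillatory_curves[of "\<beta> / C" "sqrt (- C)"] assms by (simp add: divide_neg_neg)

lemma exponential_case:
  assumes "C > 0" "\<Delta>0 > 0"
  shows "solution_curves 0 C ({1, -1} \<times> UNIV) (\<lambda>(\<sigma>, t0) t. \<Delta>0 * exp (\<sigma> * sqrt C * (t - t0)))
    (\<lambda>(\<sigma>, t0) t. \<sigma> * sqrt C * (\<Delta>0 * exp (\<sigma> * sqrt C * (t - t0)))) (\<lambda>(\<sigma>, t0). {UNIV})"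
  using exponential_curves[of \<Delta>0 "sqrt C"] assms by simp

lemma sinh_case:
  assumes "C > 0" "\<beta> < 0"
  shows "solution_curves \<beta> C UNIV (\<lambda>t0 t. - (2 * \<beta> / C) * (sinh (sqrt C / 2 * (t - t0)))\<^sup>2)
    (\<lambda>t0 t. - (\<beta> / C) * sqrt C * sinh (sqrt C * (t - t0))) (\<lambda>t0. {{t0<..}, {..<t0}})"
proof -
  have "\<beta> / C < 0" using assms by (simp add: divide_neg_pos)
  moreover have "\<beta> / C - \<beta> / C * cosh (sqrt C * u) = - (2 * \<beta> / C) * (sinh (sqrt C / 2 * u))\<^sup>2" for u
    using cosh_double[of "sqrt C / 2 * u"] by (simp add: cosh_square_eq algebra_simps)
  ultimately show ?thesis
    using hyperbolic_curves[of "\<beta> / C" "sqrt C"] assms by simp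
qed

lemma cosh_case:
  assumes "C > 0" "\<beta> > 0"
  shows "solution_curves \<beta> C UNIV (\<lambda>t0 t. 2 * \<beta> / C * (cosh (sqrt C / 2 * (t - t0)))\<^sup>2)
    (\<lambda>t0 t. \<beta> / C * sqrt C * sinh (sqrt C * (t - t0))) (\<lambda>t0. {UNIV})"
proof -
  have "\<beta> / C > 0" using assms by simp
  moreover have "\<beta> / C + \<beta> / C * cosh (sqrt C * u) = 2 * \<beta> / C * (cosh (sqrt C / 2 * u))\<^sup>2" for u
  proof -
    have "cosh (sqrt C * u) = 2 * (cosh (sqrt C / 2 * u))\<^sup>2 - 1"
      using cosh_double_cosh[of "sqrt C / 2 * u"] by simp
    then show ?thesis by (simp only:) (simp add: algebra_simps)
  qed
  ultimately show ?thesis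
    using hyperbolic_curves[of "\<beta> / C" "sqrt C"] assms by (simp add: divide_less_0_iff)
qed

lemma maximal_extension_exists:
  assumes sol: "positive_solution \<beta> C \<Delta> J" "nonsingular \<beta> C \<Delta> J"
  shows "\<exists>D I. J \<subseteq> I \<and> (\<forall>t\<in>J. D t = \<Delta> t) \<and> maximal_solution \<beta> C D I"
  using sol(1)
proof (cases rule: positive_solution_cases)
  case 1
  show ?thesis by (rule solution_curves.maximal_extension[OF oscillatory_case[OF 1] sol])
next
  case 2
  show ?thesis
    by (rule solution_curves.maximal_extension[OF parabolic_curves[OF 2(2), folded 2(1)] sol])
next
  case 3
  show ?thesis
    using solution_curves.maximal_extension[OF constant_curves] sol 3 by blast
next
  case 4
  show ?thesis by (rule solution_curves.maximal_extension[OF sinh_case[OF 4] sol])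
next
  case 5
  show ?thesis
    using solution_curves.maximal_extension[OF exponential_case[OF 5(1) zero_less_one]] sol 5 by blast
next
  case 6
  show ?thesis by (rule solution_curves.maximal_extension[OF cosh_case[OF 6] sol])
qed

lemma regime_exists:
  assumes max: "maximal_solution \<beta> C \<Delta> J"
  shows "\<exists>r. occurs r \<beta> C \<Delta> J"
proof -
  have "positive_solution \<beta> C \<Delta> J" using max by (simp add: maximal_solution_def)
  then show ?thesis
  proof (cases rule: positive_solution_cases)
    case 1
    obtain \<phi> where \<phi>: "\<And>t. t \<in> J \<Longrightarrow> \<Delta> t = \<beta> / C * (1 - cos (sqrt (- C) * t + \<phi>))"
      using solution_curves.maximal_curve[OF oscillatory_case[OF 1] max] by metis
    have "\<beta> / C > 0" "sqrt (- C) > 0" "\<beta> = - (\<beta> / C) * (sqrt (- C))\<^sup>2" "C = - ((sqrt (- C))\<^sup>2)"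
      using 1 by (simp_all add: divide_neg_neg)
    then have "occurs Oscillatory \<beta> C \<Delta> J" unfolding occurs.simps using 1 \<phi> by blast
    then show ?thesis ..
  next
    case 2
    have "occurs Parabolic \<beta> C \<Delta> J"
      using solution_curves.maximal_curve[OF parabolic_curves[OF 2(2), folded 2(1)] max] 2
      unfolding occurs.simps by metis
    then show ?thesis ..
  next
    case 3
    from max have "maximal_solution 0 0 \<Delta> J" by (simp add: 3)
    from solution_curves.maximal_curve[OF constant_curves this]
    obtain c where "c \<in> {0<..}" "\<And>t. t \<in> J \<Longrightarrow> \<Delta> t = c" by blast
    then have "occurs Constant \<beta> C \<Delta> J" using 3 by auto
    then show ?thesis ..
  next
    case 4
    have "occurs Sinh_Type \<beta> C \<Delta> J"
      using solution_curves.maximal_curve[OF sinh_case[OF 4] max] 4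
      unfolding occurs.simps by metis
    then show ?thesis ..
  next
    case 5
    from max have *: "maximal_solution 0 C \<Delta> J" by (simp add: 5(2))
    \<comment> \<open>The amplitude is normalized to 1, which loses nothing since \<open>t0\<close>
      is free.\<close>
    obtain p where p: "p \<in> {1, -1} \<times> UNIV"
      "\<And>t. t \<in> J \<Longrightarrow> \<Delta> t = (case p of (\<sigma>, t0) \<Rightarrow> \<lambda>t. 1 * exp (\<sigma> * sqrt C * (t - t0))) t"
      by (rule solution_curves.maximal_curve[OF exponential_case[OF 5(1) zero_less_one] *]) (rule that)
    obtain \<sigma> t0 where "p = (\<sigma>, t0)" by fastforce
    with p have "\<sigma> \<in> {1, -1}" "\<forall>t\<in>J. \<Delta> t = 1 * exp (\<sigma> * sqrt C * (t - t0))" by auto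
    then have "occurs Exponential \<beta> C \<Delta> J"
      unfolding occurs.simps using 5 zero_less_one by blast
    then show ?thesis ..
  next
    case 6
    have "occurs Cosh_Type \<beta> C \<Delta> J"
      using solution_curves.maximal_curve[OF cosh_case[OF 6] max] 6
      unfolding occurs.simps by metis
    then show ?thesis ..
  qed
qed

section \<open>Zeros and bounds\<close>

lemma oscillatory_zeros:
  fixes A k \<phi> :: real
  assumes "A \<noteq> 0" "k > 0"
  shows "{t. A * (1 - cos (k * t + \<phi>)) = 0} = range (\<lambda>n::int. (2 * pi * of_int n - \<phi>) / k)"
proof -
  have "cos (k * t + \<phi>) = 1 \<longleftrightarrow> (\<exists>n::int. t = (2 * pi * of_int n - \<phi>) / k)" for t
    unfolding cos_one_2pi_int using assms by (intro ex_cong1) (auto simp: field_simps)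
  then show ?thesis using assms by auto
qed

lemma oscillatory_bounded:
  assumes "C < 0" "\<beta> < 0" "maximal_solution \<beta> C \<Delta> J"
  shows "bounded (\<Delta> ` J)"
proof -
  obtain \<phi> where \<phi>: "\<And>t. t \<in> J \<Longrightarrow> \<Delta> t = \<beta> / C * (1 - cos (sqrt (- C) * t + \<phi>))"
    using solution_curves.maximal_curve[OF oscillatory_case[OF assms(1,2)] assms(3)] by metis
  have "\<bar>\<Delta> t\<bar> \<le> \<bar>\<beta> / C\<bar> * 2" if "t \<in> J" for t
  proof -
    have "\<bar>1 - cos (sqrt (- C) * t + \<phi>)\<bar> \<le> 2"
      using cos_le_one[of "sqrt (- C) * t + \<phi>"] cos_ge_minus_one[of "sqrt (- C) * t + \<phi>"]
      by linarith
    then show ?thesis unfolding \<phi>[OF that] abs_mult by (intro mult_left_mono) auto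
  qed
  then show ?thesis unfolding bounded_iff by auto
qed

lemma sinh_unbounded:
  assumes "C > 0" "\<beta> < 0" "maximal_solution \<beta> C \<Delta> J"
  shows "\<not> bdd_above (\<Delta> ` J)"
proof
  assume "bdd_above (\<Delta> ` J)"
  then obtain M where M: "\<And>t. t \<in> J \<Longrightarrow> \<Delta> t \<le> M" unfolding bdd_above_def by auto
  obtain t0 where J: "J \<in> {{t0<..}, {..<t0}}"
    and \<Delta>: "\<And>t. t \<in> J \<Longrightarrow> \<Delta> t = - (2 * \<beta> / C) * (sinh (sqrt C / 2 * (t - t0)))\<^sup>2"
    using solution_curves.maximal_curve[OF sinh_case[OF assms(1,2)] assms(3)] by metis
  define a where "a = - (2 * \<beta> / C)"
  \<comment> \<open>\<open>u\<close> is chosen so that \<open>sinh (sqrt C / 2 * u) = y\<close>.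
    Then the value at distance \<open>u\<close> from \<open>t0\<close> is \<open>a * y^2\<close>, at
    least \<open>a * y = a + \<bar>M\<bar>\<close>, which exceeds \<open>M\<close>.\<close>
  define y where "y = 1 + \<bar>M\<bar> / a"
  define u where "u = 2 / sqrt C * arsinh y"
  have "a > 0" using assms by (simp add: a_def divide_neg_pos)
  then have "y \<ge> 1" by (simp add: y_def)
  then have "u > 0" using assms by (simp add: u_def)
  \<comment> \<open>\<open>J\<close> is a half-line on either side of \<open>t0\<close>; the sign
    \<open>s\<close> steps into it and disappears in the square of \<open>sinh\<close>.\<close>
  obtain s where "s \<in> {1, -1}" "t0 + s * u \<in> J"
  proof -
    have "t0 + 1 * u \<in> J \<or> t0 + (- 1) * u \<in> J" using J \<open>u > 0\<close> by auto
    then show thesis using that by blast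
  qed
  have "sqrt C / 2 * (t0 + s * u - t0) = s * arsinh y" using assms by (simp add: u_def)
  then have "\<Delta> (t0 + s * u) = a * y\<^sup>2"
    using \<Delta>[OF \<open>t0 + s * u \<in> J\<close>] \<open>s \<in> {1, -1}\<close> by (auto simp: a_def)
  moreover have "a * y \<le> a * y\<^sup>2"
    using \<open>a > 0\<close> \<open>y \<ge> 1\<close> by (simp add: power2_eq_square)
  moreover have "a * y = a + \<bar>M\<bar>" using \<open>a > 0\<close> by (simp add: y_def field_simps)
  ultimately show False using M[OF \<open>t0 + s * u \<in> J\<close>] \<open>a > 0\<close> by linarith
qed

lemma cosh_bounded_below:
  assumes "C > 0" "\<beta> > 0" "maximal_solution \<beta> C \<Delta> J"
  shows "\<exists>m>0. \<forall>t\<in>J. m \<le> \<Delta> t"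
proof -
  obtain t0 where \<Delta>: "\<And>t. t \<in> J \<Longrightarrow> \<Delta> t = 2 * \<beta> / C * (cosh (sqrt C / 2 * (t - t0)))\<^sup>2"
    using solution_curves.maximal_curve[OF cosh_case[OF assms(1,2)] assms(3)] by metis
  have "2 * \<beta> / C * 1 \<le> \<Delta> t" if "t \<in> J" for t
    unfolding \<Delta>[OF that] using assms by (intro mult_left_mono) (auto simp: cosh_square_eq)
  then show ?thesis using assms by (intro exI[of _ "2 * \<beta> / C"]) auto
qed

theorem lemma4p3:
  fixes \<beta> C :: real
  shows
    "(\<forall>\<Delta> J. positive_solution \<beta> C \<Delta> J \<and> C < 0 \<longrightarrow> \<beta> < 0) \<and>
     (C = 0 \<and> \<beta> > 0 \<longrightarrow> \<not> (\<exists>\<Delta> J. positive_solution \<beta> C \<Delta> J)) \<and>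
     (\<forall>\<Delta> J. positive_solution \<beta> C \<Delta> J \<and> nonsingular \<beta> C \<Delta> J \<longrightarrow>
        (\<exists>D I. J \<subseteq> I \<and> (\<forall>t\<in>J. D t = \<Delta> t) \<and> maximal_solution \<beta> C D I)) \<and>
     (\<forall>\<Delta> J. maximal_solution \<beta> C \<Delta> J \<longrightarrow> (\<exists>!r. occurs r \<beta> C \<Delta> J)) \<and>
     (C < 0 \<and> \<beta> < 0 \<longrightarrow>
        solution_family \<beta> C {0..<2 * pi}
          (\<lambda>\<phi> t. \<beta> / C * (1 - cos (sqrt (- C) * t + \<phi>)))
          (\<lambda>\<phi>. range (\<lambda>n::int. {(2 * pi * of_int n - \<phi>) / sqrt (- C)
                              <..< (2 * pi * (of_int n + 1) - \<phi>) / sqrt (- C)})) \<and>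
        (\<forall>\<phi>. solves_on \<beta> C (\<lambda>t. \<beta> / C * (1 - cos (sqrt (- C) * t + \<phi>))) UNIV \<and>
             {t. \<beta> / C * (1 - cos (sqrt (- C) * t + \<phi>)) = 0} =
               range (\<lambda>n::int. (2 * pi * of_int n - \<phi>) / sqrt (- C))) \<and>
        (\<forall>\<Delta> J. maximal_solution \<beta> C \<Delta> J \<longrightarrow> bounded (\<Delta> ` J))) \<and>
     (C = 0 \<and> \<beta> < 0 \<longrightarrow>
        solution_family \<beta> C UNIV (\<lambda>t0 t. \<bar>\<beta>\<bar> / 2 * (t - t0)\<^sup>2) (\<lambda>t0. {{t0<..}, {..<t0}})) \<and>
     (C = 0 \<and> \<beta> = 0 \<longrightarrow>
        solution_family \<beta> C {0<..} (\<lambda>\<Delta>0 t. \<Delta>0) (\<lambda>\<Delta>0. {UNIV})) \<and>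
     (C > 0 \<and> \<beta> < 0 \<longrightarrow>
        solution_family \<beta> C UNIV
          (\<lambda>t0 t. - (2 * \<beta> / C) * (sinh (sqrt C / 2 * (t - t0)))\<^sup>2)
          (\<lambda>t0. {{t0<..}, {..<t0}}) \<and>
        (\<forall>t0. solves_on \<beta> C (\<lambda>t. - (2 * \<beta> / C) * (sinh (sqrt C / 2 * (t - t0)))\<^sup>2) UNIV \<and>
              {t. - (2 * \<beta> / C) * (sinh (sqrt C / 2 * (t - t0)))\<^sup>2 = 0} = {t0}) \<and>
        (\<forall>\<Delta> J. maximal_solution \<beta> C \<Delta> J \<longrightarrow> \<not> bdd_above (\<Delta> ` J))) \<and>
     (C > 0 \<and> \<beta> = 0 \<longrightarrow>
        (\<forall>\<Delta>0>0. solution_family \<beta> C ({1, -1} \<times> UNIV)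
           (\<lambda>(\<sigma>, t0) t. \<Delta>0 * exp (\<sigma> * sqrt C * (t - t0))) (\<lambda>(\<sigma>, t0). {UNIV}))) \<and>
     (C > 0 \<and> \<beta> > 0 \<longrightarrow>
        solution_family \<beta> C UNIV
          (\<lambda>t0 t. 2 * \<beta> / C * (cosh (sqrt C / 2 * (t - t0)))\<^sup>2) (\<lambda>t0. {UNIV}) \<and>
        (\<forall>\<Delta> J. maximal_solution \<beta> C \<Delta> J \<longrightarrow> (\<exists>m>0. \<forall>t\<in>J. m \<le> \<Delta> t))) \<and>
     (\<beta> < 0 \<longrightarrow>
        (\<exists>C1 \<Delta> J. C1 < 0 \<and> maximal_solution \<beta> C1 \<Delta> J \<and> bounded (\<Delta> ` J)) \<and>
        (\<exists>C2 \<Delta> J. C2 > 0 \<and> maximal_solution \<beta> C2 \<Delta> J \<and> \<not> bounded (\<Delta> ` J)))"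
proof (intro conjI)
  show "\<forall>\<Delta> J. positive_solution \<beta> C \<Delta> J \<and> C < 0 \<longrightarrow> \<beta> < 0"
    by (auto elim: positive_solution_cases)
  show "C = 0 \<and> \<beta> > 0 \<longrightarrow> \<not> (\<exists>\<Delta> J. positive_solution \<beta> C \<Delta> J)"
    by (auto elim: positive_solution_cases)
  show "\<forall>\<Delta> J. positive_solution \<beta> C \<Delta> J \<and> nonsingular \<beta> C \<Delta> J \<longrightarrow>
      (\<exists>D I. J \<subseteq> I \<and> (\<forall>t\<in>J. D t = \<Delta> t) \<and> maximal_solution \<beta> C D I)"
    using maximal_extension_exists by blast
  show "\<forall>\<Delta> J. maximal_solution \<beta> C \<Delta> J \<longrightarrow> (\<exists>!r. occurs r \<beta> C \<Delta> J)"
    using regime_exists occurs_unique by blast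
  show "\<beta> < 0 \<longrightarrow>
      (\<exists>C1 \<Delta> J. C1 < 0 \<and> maximal_solution \<beta> C1 \<Delta> J \<and> bounded (\<Delta> ` J)) \<and>
      (\<exists>C2 \<Delta> J. C2 > 0 \<and> maximal_solution \<beta> C2 \<Delta> J \<and> \<not> bounded (\<Delta> ` J))"
  proof (intro impI conjI)
    assume "\<beta> < 0"
    \<comment> \<open>Here \<open>C1 = - 1\<close> and below \<open>C2 = 1\<close> serve as sample
      values of the two signs, with the same \<open>\<beta>\<close>.\<close>
    obtain \<Delta> J where *: "maximal_solution \<beta> (- 1) \<Delta> J"
      using solution_curves.maximal[OF oscillatory_case[of "- 1" \<beta>], of 0] \<open>\<beta> < 0\<close> by fastforce
    then have "bounded (\<Delta> ` J)" using oscillatory_bounded[of "- 1" \<beta> \<Delta> J] \<open>\<beta> < 0\<close> by simp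
    with * show "\<exists>C1 \<Delta> J. C1 < 0 \<and> maximal_solution \<beta> C1 \<Delta> J \<and> bounded (\<Delta> ` J)"
      by (intro exI[of _ "- 1"] exI[of _ \<Delta>] exI[of _ J]) simp
    obtain \<Delta> J where *: "maximal_solution \<beta> 1 \<Delta> J"
      using solution_curves.maximal[OF sinh_case[OF zero_less_one \<open>\<beta> < 0\<close>] UNIV_I insertI1]
      by (rule that)
    then have "\<not> bounded (\<Delta> ` J)"
      using sinh_unbounded[of 1 \<beta> \<Delta> J] bounded_imp_bdd_above \<open>\<beta> < 0\<close> by auto
    with * show "\<exists>C2 \<Delta> J. C2 > 0 \<and> maximal_solution \<beta> C2 \<Delta> J \<and> \<not> bounded (\<Delta> ` J)"
      by (intro exI[of _ 1] exI[of _ \<Delta>] exI[of _ J]) simp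
  qed
  show "C < 0 \<and> \<beta> < 0 \<longrightarrow>
        solution_family \<beta> C {0..<2 * pi}
          (\<lambda>\<phi> t. \<beta> / C * (1 - cos (sqrt (- C) * t + \<phi>)))
          (\<lambda>\<phi>. range (\<lambda>n::int. {(2 * pi * of_int n - \<phi>) / sqrt (- C)
                              <..< (2 * pi * (of_int n + 1) - \<phi>) / sqrt (- C)})) \<and>
        (\<forall>\<phi>. solves_on \<beta> C (\<lambda>t. \<beta> / C * (1 - cos (sqrt (- C) * t + \<phi>))) UNIV \<and>
             {t. \<beta> / C * (1 - cos (sqrt (- C) * t + \<phi>)) = 0} =
               range (\<lambda>n::int. (2 * pi * of_int n - \<phi>) / sqrt (- C))) \<and>
        (\<forall>\<Delta> J. maximal_solution \<beta> C \<Delta> J \<longrightarrow> bounded (\<Delta> ` J))"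
    using solution_curves.family[OF oscillatory_case] oscillatory_bounded
      oscillatory_solves[of "\<beta> / C" "sqrt (- C)"] oscillatory_zeros[of "\<beta> / C" "sqrt (- C)"] by (intro impI conjI allI) auto
  show "C = 0 \<and> \<beta> < 0 \<longrightarrow>
        solution_family \<beta> C UNIV (\<lambda>t0 t. \<bar>\<beta>\<bar> / 2 * (t - t0)\<^sup>2) (\<lambda>t0. {{t0<..}, {..<t0}})"
    using solution_curves.family[OF parabolic_curves] by blast
  show "C = 0 \<and> \<beta> = 0 \<longrightarrow>
        solution_family \<beta> C {0<..} (\<lambda>\<Delta>0 t. \<Delta>0) (\<lambda>\<Delta>0. {UNIV})"
    using solution_curves.family[OF constant_curves] by blast
  show "C > 0 \<and> \<beta> < 0 \<longrightarrow>
        solution_family \<beta> C UNIV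
          (\<lambda>t0 t. - (2 * \<beta> / C) * (sinh (sqrt C / 2 * (t - t0)))\<^sup>2)
          (\<lambda>t0. {{t0<..}, {..<t0}}) \<and>
        (\<forall>t0. solves_on \<beta> C (\<lambda>t. - (2 * \<beta> / C) * (sinh (sqrt C / 2 * (t - t0)))\<^sup>2) UNIV \<and>
              {t. - (2 * \<beta> / C) * (sinh (sqrt C / 2 * (t - t0)))\<^sup>2 = 0} = {t0}) \<and>
        (\<forall>\<Delta> J. maximal_solution \<beta> C \<Delta> J \<longrightarrow> \<not> bdd_above (\<Delta> ` J))"
    using solution_curves.family[OF sinh_case] solution_curves.solves[OF sinh_case] sinh_unbounded by auto
  show "C > 0 \<and> \<beta> = 0 \<longrightarrow>
        (\<forall>\<Delta>0>0. solution_family \<beta> C ({1, -1} \<times> UNIV)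
           (\<lambda>(\<sigma>, t0) t. \<Delta>0 * exp (\<sigma> * sqrt C * (t - t0))) (\<lambda>(\<sigma>, t0). {UNIV}))"
    using solution_curves.family[OF exponential_case] by blast
  show "C > 0 \<and> \<beta> > 0 \<longrightarrow>
        solution_family \<beta> C UNIV
          (\<lambda>t0 t. 2 * \<beta> / C * (cosh (sqrt C / 2 * (t - t0)))\<^sup>2) (\<lambda>t0. {UNIV}) \<and>
        (\<forall>\<Delta> J. maximal_solution \<beta> C \<Delta> J \<longrightarrow> (\<exists>m>0. \<forall>t\<in>J. m \<le> \<Delta> t))"
    using solution_curves.family[OF cosh_case] cosh_bounded_below by blast
qed

end
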